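(* Let $p$ be a natural number, and let $\Omega\subset\mathbb{C}$ with $0\notin\overline{\Omega}$ be a smooth bounded one-point quadrature domain with respect to the weighted area measure $|z|^{2p-2}dA$. Then $\Omega$ is a $p$th root of a disc.
   Context: Natural numbers are $1,2,3,\dots$; $dA$ is Lebesgue area measure; a smooth bounded domain is a bounded connected open set with $\mathcal{C}^\infty$ smooth boundary. $\mathcal{A}^\infty(\Omega)$ is the space of analytic functions on $\Omega$ that are $\mathcal{C}^\infty$ smooth up to the boundary. $\Omega$ is a one-point quadrature domain with respect to $|z|^{2p-2}dA$ if there are a constant $c\in\mathbb{C}$ and a point $z_0\in\Omega$ (the quadrature node) such that $\int_\Omega f(z)|z|^{2p-2}dA=c\,f(z_0)$ for all $f\in\mathcal{A}^\infty(\Omega)$. A $p$th root of a disc is a set of the form $\{\sqrt[p]{z}:|z-a|<r\}$ with $a\in\mathbb{C}$ and $0<r<|a|$, where $\sqrt[p]{z}$ denotes an analytic branch of $z^{1/p}$ on the disc $|z-a|<r$. *)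

theory Defs
  imports "HOL-Analysis.Analysis"
begin

text \<open>
  Real \<open>C\<^sup>k\<close> smoothness on an open set, by recursion over directional derivatives:
  the function is differentiable, and \<open>x \<mapsto> Df(x) v\<close> is \<open>C\<^sup>k\<^sup>-\<^sup>1\<close> for every fixed direction \<open>v\<close>.
\<close>

primrec Ck_on ::
  "nat \<Rightarrow> ('a::real_normed_vector \<Rightarrow> 'b::real_normed_vector) \<Rightarrow> 'a set \<Rightarrow> bool"
where
  "Ck_on 0 f S \<longleftrightarrow> continuous_on S f"
| "Ck_on (Suc k) f S \<longleftrightarrow>
     f differentiable_on S \<and> (\<forall>v. Ck_on k (\<lambda>x. frechet_derivative f (at x) v) S)"

definition Cinf_on ::
  "('a::real_normed_vector \<Rightarrow> 'b::real_normed_vector) \<Rightarrow> 'a set \<Rightarrow> bool"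
where
  "Cinf_on f S \<longleftrightarrow> (\<forall>k. Ck_on k f S)"

text \<open>
  Smoothness of the boundary, by local defining functions: near each boundary point the set
  is \<open>{\<rho> < 0}\<close> for a \<open>C\<^sup>\<infinity>\<close> real function \<open>\<rho>\<close> without critical points, so that the boundary
  is locally the smooth curve \<open>{\<rho> = 0}\<close> and the set lies on one side of it.
\<close>

definition smooth_boundary :: "complex set \<Rightarrow> bool" where
  "smooth_boundary \<Omega> \<longleftrightarrow>
     (\<forall>q \<in> frontier \<Omega>. \<exists>U (\<rho> :: complex \<Rightarrow> real).
        open U \<and> q \<in> U \<and> Cinf_on \<rho> U \<and>
        (\<forall>z\<in>U. frechet_derivative \<rho> (at z) \<noteq> (\<lambda>v. 0)) \<and>
        \<Omega> \<inter> U = {z \<in> U. \<rho> z < 0})"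

definition smooth_bounded_domain :: "complex set \<Rightarrow> bool" where
  "smooth_bounded_domain \<Omega> \<longleftrightarrow>
     open \<Omega> \<and> connected \<Omega> \<and> \<Omega> \<noteq> {} \<and> bounded \<Omega> \<and> smooth_boundary \<Omega>"

text \<open>
  Smoothness up to the boundary: derivatives of all orders extend continuously to the closure.
  For holomorphic \<open>f\<close>, every real partial derivative of order \<open>n\<close> is the \<open>n\<close>-th complex
  derivative times a power of \<open>\<i>\<close>, so the complex derivatives suffice. Only the values
  of \<open>f\<close> on \<open>\<Omega>\<close> matter.
\<close>

definition A_infinity :: "complex set \<Rightarrow> (complex \<Rightarrow> complex) set" where
  "A_infinity \<Omega> =
     {f. f holomorphic_on \<Omega> \<and>
         (\<forall>n. \<exists>g. continuous_on (closure \<Omega>) g \<and> (\<forall>z\<in>\<Omega>. g z = (deriv ^^ n) f z))}"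

text \<open>
  The weight is \<open>|z|\<^sup>2\<^sup>p\<^sup>-\<^sup>2\<close> with exponent in the natural numbers; it is meant for \<open>p \<ge> 1\<close>,
  where the subtraction does not truncate.
\<close>

definition one_point_quadrature_domain :: "nat \<Rightarrow> complex set \<Rightarrow> bool" where
  "one_point_quadrature_domain p \<Omega> \<longleftrightarrow>
     (\<exists>c. \<exists>z0\<in>\<Omega>. \<forall>f \<in> A_infinity \<Omega>.
        (LINT z:\<Omega>|lebesgue. f z * complex_of_real (norm z ^ (2 * p - 2))) = c * f z0)"

definition is_pth_root_of_disc :: "nat \<Rightarrow> complex set \<Rightarrow> bool" where
  "is_pth_root_of_disc p \<Omega> \<longleftrightarrow>
     (\<exists>a r g. 0 < r \<and> r < norm a \<and>
        g holomorphic_on ball a r \<and> (\<forall>z \<in> ball a r. g z ^ p = z) \<and>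
        \<Omega> = g ` ball a r)"

end

theory Submission
  imports Defs "HOL-Complex_Analysis.Complex_Analysis"
begin

text \<open>
  Testing the quadrature identity on \<open>f z = 1 / (z\<^sup>p\<^sup>-\<^sup>1 (w - z))\<close> shows that the Cauchy transform
  \<open>C w\<close> of the density \<open>cnj z\<^sup>p\<^sup>-\<^sup>1\<close> on \<open>\<Omega>\<close> equals \<open>k / (w - z0)\<close> outside \<open>closure \<Omega>\<close>, and by
  continuity also on the boundary, which consists of limits of exterior points. Inside \<open>\<Omega>\<close> the
  difference \<open>C w - \<pi> cnj w\<^sup>p / p\<close> is holomorphic. Hence \<open>cnj w\<^sup>p\<close> has on the boundary the same
  values as a meromorphic function with a single simple pole, at \<open>z0\<close>. With \<open>a = z0\<^sup>p\<close>, the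
  function \<open>|w\<^sup>p - a|\<^sup>2 = (w\<^sup>p - a) (cnj w\<^sup>p - cnj a)\<close> is then the real boundary value of a function
  holomorphic in \<open>\<Omega>\<close>, so it is a constant \<open>\<rho>\<^sup>2\<close>. By the maximum principle \<open>\<Omega>\<close> is a component of
  \<open>{|w\<^sup>p - a| < \<rho>}\<close>, and \<open>0 \<notin> closure \<Omega>\<close> forces \<open>\<rho> < |a|\<close>.
\<close>

section \<open>Integrability of \<open>|u| powr (-3/2)\<close> in the plane\<close>

lemma measurable_Complex [measurable]:
  "(\<lambda>(x, y). Complex x y) \<in> borel_measurable (borel \<Otimes>\<^sub>M borel)"
  unfolding Complex_eq by measurable

text \<open>Lebesgue measure is determined by its values on boxes, and on a box both sides give the
  product of the two side lengths. This makes Fubini available in the coordinates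
  \<open>Re z\<close> and \<open>Im z\<close>.\<close>

lemma lborel_complex_eq_distr:
  "distr (lborel \<Otimes>\<^sub>M lborel) borel (\<lambda>(x, y). Complex x y) = lborel"
proof (rule lborel_eqI[symmetric])
  fix l u :: complex assume le: "\<And>b. b \<in> Basis \<Longrightarrow> l \<bullet> b \<le> u \<bullet> b"
  have le': "Re l \<le> Re u" "Im l \<le> Im u"
    using le[of 1] le[of \<i>] by (auto simp: Basis_complex_def inner_complex_def)
  have "(\<lambda>(x, y). Complex x y) -` box l u \<inter> space (lborel \<Otimes>\<^sub>M lborel) =
      {Re l <..< Re u} \<times> {Im l <..< Im u}"
    by (auto simp: in_box_complex_iff space_pair_measure)
  then show "emeasure (distr (lborel \<Otimes>\<^sub>M lborel) borel (\<lambda>(x, y). Complex x y)) (box l u) =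
      (\<Prod>b\<in>Basis. (u - l) \<bullet> b)"
    using le' by (subst emeasure_distr)
      (auto simp: lborel.emeasure_pair_measure_Times Basis_complex_def inner_complex_def
        ennreal_mult)
qed simp

lemma integral_complex_eq_pair:
  fixes f :: "complex \<Rightarrow> 'a :: {banach, second_countable_topology}"
  assumes "f \<in> borel_measurable borel"
  shows "integral\<^sup>L lborel f = integral\<^sup>L (lborel \<Otimes>\<^sub>M lborel) (\<lambda>(x, y). f (Complex x y))"
    and "integrable lborel f \<longleftrightarrow> integrable (lborel \<Otimes>\<^sub>M lborel) (\<lambda>(x, y). f (Complex x y))"
proof -
  show "integral\<^sup>L lborel f = integral\<^sup>L (lborel \<Otimes>\<^sub>M lborel) (\<lambda>(x, y). f (Complex x y))"
    using assms by (subst lborel_complex_eq_distr[symmetric], subst integral_distr)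
      (auto simp: case_prod_unfold)
  show "integrable lborel f \<longleftrightarrow> integrable (lborel \<Otimes>\<^sub>M lborel) (\<lambda>(x, y). f (Complex x y))"
    using assms by (subst lborel_complex_eq_distr[symmetric], subst integrable_distr_eq)
      (auto simp: case_prod_unfold)
qed

lemma AE_inner_Basis_neq:
  fixes b :: "'a :: euclidean_space"
  assumes "b \<in> Basis"
  shows "AE z in lborel. z \<bullet> b \<noteq> c"
proof -
  have "{z. z \<bullet> b = c} \<in> null_sets lebesgue"
    using negligible_standard_hyperplane[OF assms] by (simp add: negligible_iff_null_sets)
  moreover have "{z. z \<bullet> b = c} \<in> sets lborel" by measurable
  ultimately have "{z. z \<bullet> b = c} \<in> null_sets lborel"
    using null_sets_completion_iff by blast
  from AE_not_in[OF this] show ?thesis by simp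
qed

lemma AE_Re_neq: "AE z in lborel. Re z \<noteq> c"
  using AE_inner_Basis_neq[of "1::complex" c] by (simp add: Basis_complex_def inner_complex_def)

lemma AE_Im_neq: "AE z in lborel. Im z \<noteq> c"
  using AE_inner_Basis_neq[of \<i> c] by (simp add: Basis_complex_def inner_complex_def)

lemma integrable_abs_powr:
  assumes "a > -1"
  shows "integrable lborel (\<lambda>x::real. indicator {-1..1} x * \<bar>x\<bar> powr a)"
proof -
  let ?f = "\<lambda>x::real. indicator {0..1} x * x powr a"
  have "(\<lambda>x. x powr a) absolutely_integrable_on {0..1}"
    using integrable_on_powr_from_0[OF assms, of 1]
    by (subst absolutely_integrable_on_iff_nonneg) auto
  then have f: "integrable lborel ?f"
    unfolding set_integrable_def by (subst (asm) integrable_completion) auto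
  \<comment> \<open>The mirror image of \<open>?f\<close>. The two halves overlap only at 0, where
    \<open>0 powr a = 0\<close>, so their sum is the even function everywhere.\<close>
  have "integrable lborel (\<lambda>x. ?f (0 + (-1) * x))"
    by (rule lborel_integrable_real_affine[OF f]) simp
  from Bochner_Integration.integrable_add[OF f this]
  show ?thesis
    by (rule integrable_cong_AE_imp)
       (auto intro!: AE_I2 simp: indicator_def)
qed

text \<open>Since \<open>|Re u * Im u| \<le> |u|\<^sup>2\<close>, this product dominates \<open>|u| powr (-3/2)\<close> near \<open>0\<close>
  (off the axes, where \<open>0 powr a = 0\<close> spoils the bound), and Fubini makes it integrable.\<close>

definition box_kernel :: "complex \<Rightarrow> real" where
  "box_kernel u = (indicator {-1..1} (Re u) * \<bar>Re u\<bar> powr (-3/4)) *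
     (indicator {-1..1} (Im u) * \<bar>Im u\<bar> powr (-3/4))"

lemma box_kernel_measurable [measurable]: "box_kernel \<in> borel_measurable borel"
  unfolding box_kernel_def by measurable

lemma integrable_box_kernel: "integrable lborel box_kernel"
proof -
  let ?f = "\<lambda>x::real. indicator {-1..1} x * \<bar>x\<bar> powr (-3/4)"
  have "integrable (lborel \<Otimes>\<^sub>M lborel) (\<lambda>(x, y). ?f x * ?f y)"
    by (rule lborel_pair.Fubini_integrable)
       (auto intro!: integrable_mult_left integrable_mult_right integrable_abs_powr
          simp: abs_mult Bochner_Integration.integral_mult_right_zero case_prod_unfold)
  then show ?thesis
    by (subst integral_complex_eq_pair(2)) (simp_all add: box_kernel_def[abs_def])
qed

lemma box_kernel_translation:
  "integrable lborel (\<lambda>z. box_kernel (z - w))"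
  "integral\<^sup>L lborel (\<lambda>z. box_kernel (z - w)) = integral\<^sup>L lborel box_kernel"
proof -
  have eq: "distr lborel borel (\<lambda>z::complex. -w + z) = lborel"
    by (rule lborel_distr_plus)
  show "integral\<^sup>L lborel (\<lambda>z. box_kernel (z - w)) = integral\<^sup>L lborel box_kernel"
    by (subst (2) eq[symmetric], subst integral_distr) auto
  show "integrable lborel (\<lambda>z. box_kernel (z - w))"
    using integrable_box_kernel
    by (subst (asm) eq[symmetric], subst (asm) integrable_distr_eq) auto
qed

lemma norm_powr_le_box_kernel:
  assumes "Re u \<noteq> 0" "Im u \<noteq> 0"
  shows "norm u powr (-3/2) \<le> 1 + box_kernel u"
proof (cases "norm u \<ge> 1")
  case True
  then have "norm u powr (-3/2) \<le> 1 powr (-3/2)"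
    by (intro powr_mono2') auto
  moreover have "box_kernel u \<ge> 0" by (simp add: box_kernel_def)
  ultimately show ?thesis by simp
next
  case False
  then have le1: "\<bar>Re u\<bar> \<le> 1" "\<bar>Im u\<bar> \<le> 1"
    using abs_Re_le_cmod[of u] abs_Im_le_cmod[of u] by linarith+
  have "0 \<le> (\<bar>Re u\<bar> - \<bar>Im u\<bar>)\<^sup>2" by simp
  then have "2 * (\<bar>Re u\<bar> * \<bar>Im u\<bar>) \<le> norm u ^ 2"
    by (simp add: cmod_power2 power2_diff mult.assoc)
  moreover have "0 \<le> \<bar>Re u\<bar> * \<bar>Im u\<bar>" by simp
  ultimately have "\<bar>Re u\<bar> * \<bar>Im u\<bar> \<le> norm u ^ 2" by linarith
  then have "(norm u ^ 2) powr (-3/4) \<le> (\<bar>Re u\<bar> * \<bar>Im u\<bar>) powr (-3/4)"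
    using assms by (intro powr_mono2') auto
  also have "(norm u ^ 2) powr (-3/4) = norm u powr (-3/2)"
    by (simp add: powr_powr powr_numeral[symmetric] del: powr_numeral)
  finally show ?thesis using le1 by (auto simp: box_kernel_def powr_mult indicator_def)
qed

text \<open>One \<open>K\<close> serves all \<open>w\<close>: the dominating function is the
  indicator of \<open>S\<close> plus a translate of \<open>box_kernel\<close>, and Lebesgue measure
  is translation invariant. This uniformity later yields Hoelder continuity.\<close>

lemma riesz_kernel_bound:
  assumes S [measurable]: "S \<in> sets borel" and fin: "emeasure lborel S < \<infinity>"
  obtains K where "K \<ge> 0"
    "\<And>w::complex. integrable lborel (\<lambda>z. indicator S z * norm (z - w) powr (-3/2))"
    "\<And>w. (LINT z|lborel. indicator S z * norm (z - w) powr (-3/2)) \<le> K"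
proof
  let ?K = "(LINT z|lborel. indicator S z) + integral\<^sup>L lborel box_kernel"
  have knn: "box_kernel u \<ge> 0" for u by (simp add: box_kernel_def)
  have dom: "integrable lborel (\<lambda>z. indicator S z + box_kernel (z - w))" for w
    using fin by (intro Bochner_Integration.integrable_add box_kernel_translation) simp
  have ae: "AE z in lborel. norm (indicator S z * norm (z - w) powr (-3/2)) \<le>
      indicator S z + box_kernel (z - w)" for w
    using AE_Re_neq[of "Re w"] AE_Im_neq[of "Im w"]
  proof eventually_elim
    case (elim z)
    then show ?case using norm_powr_le_box_kernel[of "z - w"] knn[of "z - w"]
      by (auto simp: indicator_def)
  qed
  show int: "integrable lborel (\<lambda>z. indicator S z * norm (z - w) powr (-3/2))" for w
    by (rule Bochner_Integration.integrable_bound[OF dom[of w]])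
      (use ae[of w] in \<open>auto elim!: eventually_mono\<close>)
  show "?K \<ge> 0" by (intro add_nonneg_nonneg integral_nonneg_AE) (auto simp: knn)
  show "(LINT z|lborel. indicator S z * norm (z - w) powr (-3/2)) \<le> ?K" for w
  proof -
    have "(LINT z|lborel. indicator S z * norm (z - w) powr (-3/2)) \<le>
        (LINT z|lborel. indicator S z + box_kernel (z - w))"
      by (rule integral_mono_AE[OF int dom]) (use ae[of w] in \<open>auto elim!: eventually_mono\<close>)
    also have "\<dots> = ?K"
      using fin by (subst Bochner_Integration.integral_add) (auto simp: box_kernel_translation)
    finally show ?thesis .
  qed
qed

section \<open>The Cauchy transform\<close>

text \<open>The kernel is \<open>1 / (w - z)\<close> without the usual factor \<open>1 / pi\<close>.
  At \<open>z = w\<close> division by zero gives 0, which affects only a null set.\<close>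

definition cauchy_transform :: "complex set \<Rightarrow> (complex \<Rightarrow> complex) \<Rightarrow> complex \<Rightarrow> complex" where
  "cauchy_transform S \<phi> w = (LINT z:S|lborel. \<phi> z / (w - z))"

text \<open>Lets the kernel with exponent -3/2 control the Cauchy kernel as well, including at
  \<open>a = 0\<close>, where \<open>1 / a\<close> is 0.\<close>

lemma inverse_le_1_plus_powr:
  fixes a :: real assumes "a \<ge> 0" shows "1 / a \<le> 1 + a powr (-3/2)"
proof (cases "a \<ge> 1 \<or> a = 0")
  case True
  then have "1 / a \<le> 1" by auto
  then show ?thesis by (simp add: add_increasing2)
next
  case False
  with assms have a: "0 < a" "a < 1" by auto
  have "1 / a = a powr (-1)" using a by (simp add: powr_minus_divide)
  also have "\<dots> \<le> a powr (-3/2)" using a by (intro powr_mono') auto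
  finally show ?thesis by simp
qed

lemma set_integrable_cauchy_kernel:
  fixes S :: "complex set" and \<phi> :: "complex \<Rightarrow> complex"
  assumes [measurable]: "S \<in> sets borel" and fin: "emeasure lborel S < \<infinity>"
    and [measurable]: "\<phi> \<in> borel_measurable borel" and bd: "\<And>z. z \<in> S \<Longrightarrow> norm (\<phi> z) \<le> B"
  shows "set_integrable lborel S (\<lambda>z. \<phi> z / (w - z))"
proof -
  obtain K where K: "K \<ge> 0"
    "\<And>w. integrable lborel (\<lambda>z. indicator S z * norm (z - w) powr (-3/2))"
    "\<And>w. (LINT z|lborel. indicator S z * norm (z - w) powr (-3/2)) \<le> K"
    using riesz_kernel_bound[OF assms(1,2)] by metis
  have B: "integrable lborel (\<lambda>z. B * (indicator S z + indicator S z * norm (z - w) powr (-3/2)))"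
    using fin by (intro integrable_mult_right Bochner_Integration.integrable_add K) simp
  show ?thesis unfolding set_integrable_def
  proof (rule Bochner_Integration.integrable_bound[OF B])
    show "AE z in lborel. norm (indicator S z *\<^sub>R (\<phi> z / (w - z))) \<le>
        norm (B * (indicator S z + indicator S z * norm (z - w) powr (-3/2)))"
    proof (rule AE_I2)
      fix z
      show "norm (indicator S z *\<^sub>R (\<phi> z / (w - z))) \<le>
        norm (B * (indicator S z + indicator S z * norm (z - w) powr (-3/2)))"
      proof (cases "z \<in> S")
        case True
        have "norm (\<phi> z / (w - z)) = norm (\<phi> z) * (1 / norm (z - w))"
          by (simp add: norm_divide norm_minus_commute)
        also have "\<dots> \<le> B * (1 + norm (z - w) powr (-3/2))"
          using bd[OF True] by (intro mult_mono inverse_le_1_plus_powr) (auto intro: order_trans[OF norm_ge_zero])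
        also have "\<dots> \<le> norm (B * (1 + norm (z - w) powr (-3/2)))" by simp
        finally show ?thesis using True by simp
      qed simp
    qed
  qed measurable
qed

text \<open>Write \<open>a \<le> b\<close> for the distances of \<open>z\<close> to the two points
  and \<open>D\<close> for the distance between them, so the left side is
  \<open>D / (a * b)\<close>. The triangle inequality gives \<open>sqrt D \<le> 2 * sqrt b\<close>;
  spending one factor \<open>sqrt D\<close> this way leaves
  \<open>2 * sqrt D / (a * sqrt b)\<close>, at most \<open>2 * sqrt D * a powr (-3/2)\<close>. The
  exponent -3/2 is still integrable in the plane.\<close>

lemma cauchy_kernel_Hoelder:
  fixes w w' z :: complex
  shows "norm (1 / (w - z) - 1 / (w' - z)) \<le>
    2 * sqrt (norm (w - w')) * (norm (z - w) powr (-3/2) + norm (z - w') powr (-3/2))"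
proof (cases "z = w \<or> z = w'")
  case True
  \<comment> \<open>If \<open>z\<close> is one of the two points, the terms singular there are 0 by
    convention and only the distance \<open>a\<close> between the points remains.\<close>
  have inv: "1 / a \<le> 2 * sqrt a * a powr (-3/2)" if "a \<ge> 0" for a :: real
  proof (cases "a = 0")
    case False
    with that have "sqrt a * a powr (-3/2) = a powr (1/2 + (-3/2))"
      by (simp only: powr_add powr_half_sqrt)
    also have "\<dots> = 1 / a" using False that by (simp add: powr_minus_divide)
    finally have "2 * sqrt a * a powr (-3/2) = 2 * (1 / a)" by (simp add: mult.assoc)
    then show ?thesis using that False by (simp add: divide_simps)
  qed simp
  from True show ?thesis
    using inv[of "norm (w - w')"] by (auto simp: norm_divide norm_minus_commute)
next
  case False
  then have assms: "z \<noteq> w" "z \<noteq> w'" by auto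
  have main: "D / (a * b) \<le> 2 * sqrt D * (a powr (-3/2) + b powr (-3/2))"
    if "0 < a" "a \<le> b" "0 \<le> D" "D \<le> a + b" for a b D :: real
  proof -
    have "sqrt D \<le> sqrt (4 * b)" using that by (intro real_sqrt_le_mono) auto
    also have "\<dots> = 2 * sqrt b" by (simp add: real_sqrt_mult)
    finally have "D / (a * b) \<le> sqrt D * (2 * sqrt b) / (a * b)"
      using that mult_left_mono[of "sqrt D" "2 * sqrt b" "sqrt D"]
      by (intro divide_right_mono) auto
    also have "\<dots> = 2 * sqrt D * (b powr (-1/2) / a)"
      using that by (simp add: powr_half_sqrt powr_minus_divide real_sqrt_divide field_simps)
    also have "b powr (-1/2) / a \<le> a powr (-1/2) / a"
      using that by (intro divide_right_mono powr_mono2') auto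
    also have "a powr (-1/2) / a = a powr (-3/2)"
      using that powr_diff[of a "-1/2" 1] by simp
    also have "\<dots> \<le> a powr (-3/2) + b powr (-3/2)" by simp
    finally show ?thesis using that by (simp add: mult_left_mono)
  qed
  have tri: "norm (w - w') \<le> norm (z - w) + norm (z - w')"
    using norm_triangle_ineq[of "w - z" "z - w'"] by (simp add: norm_minus_commute)
  have "1 / (w - z) - 1 / (w' - z) = (w' - w) / ((w - z) * (w' - z))"
    using assms by (simp add: divide_simps)
  then have "norm (1 / (w - z) - 1 / (w' - z)) = norm (w - w') / (norm (z - w) * norm (z - w'))"
    by (simp add: norm_divide norm_mult norm_minus_commute)
  also have "\<dots> \<le> 2 * sqrt (norm (w - w')) * (norm (z - w) powr (-3/2) + norm (z - w') powr (-3/2))"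
    using main[of "norm (z - w)" "norm (z - w')" "norm (w - w')"]
      main[of "norm (z - w')" "norm (z - w)" "norm (w - w')"] tri assms
    by (cases "norm (z - w) \<le> norm (z - w')") (auto simp: mult.commute add.commute)
  finally show ?thesis .
qed

text \<open>Integrating the kernel estimate against the bounded density shows that the transform is
  Hoelder continuous with exponent 1/2 on the whole plane.\<close>

lemma continuous_on_cauchy_transform:
  fixes S :: "complex set" and \<phi> :: "complex \<Rightarrow> complex"
  assumes [measurable]: "S \<in> sets borel" and fin: "emeasure lborel S < \<infinity>"
    and [measurable]: "\<phi> \<in> borel_measurable borel" and bd: "\<And>z. z \<in> S \<Longrightarrow> norm (\<phi> z) \<le> B"
  shows "continuous_on X (cauchy_transform S \<phi>)"
proof -
  obtain K where K: "K \<ge> 0"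
    "\<And>w::complex. integrable lborel (\<lambda>z. indicator S z * norm (z - w) powr (-3/2))"
    "\<And>w. (LINT z|lborel. indicator S z * norm (z - w) powr (-3/2)) \<le> K"
    using riesz_kernel_bound[OF assms(1,2)] by metis
  \<comment> \<open>A bound for the density, the factor 2 of the kernel estimate, and
    \<open>K\<close> for each of its two kernels. The absolute value matters if \<open>S\<close> is
    empty, when \<open>B\<close> may be negative.\<close>
  define L where "L = \<bar>B\<bar> * 2 * (2 * K)"
  have int: "set_integrable lborel S (\<lambda>z. \<phi> z / (w - z))" for w
    by (rule set_integrable_cauchy_kernel[OF assms]) auto
  have bound: "norm (cauchy_transform S \<phi> w - cauchy_transform S \<phi> w') \<le> L * sqrt (norm (w - w'))" for w w'
  proof -
    let ?k = "\<lambda>w z. indicator S z * norm (z - w) powr (-3/2)"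
    let ?c = "\<bar>B\<bar> * 2 * sqrt (norm (w - w'))"
    have "cauchy_transform S \<phi> w - cauchy_transform S \<phi> w' =
        (LINT z:S|lborel. \<phi> z / (w - z) - \<phi> z / (w' - z))"
      unfolding cauchy_transform_def by (rule set_integral_diff(2)[symmetric]) (rule int)+
    also have "norm \<dots> \<le> (LINT z|lborel. ?c * (?k w z + ?k w' z))"
      unfolding set_lebesgue_integral_def
    proof (rule Bochner_Integration.integral_norm_bound_integral, goal_cases)
      case 1
      have "set_integrable lborel S (\<lambda>z. \<phi> z / (w - z) - \<phi> z / (w' - z))"
        by (intro set_integral_diff int)
      then show ?case by (simp add: set_integrable_def)
    next
      case 2
      then show ?case by (intro integrable_mult_right Bochner_Integration.integrable_add K)
    next
      case (3 z)
      show ?case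
      proof (cases "z \<in> S")
        case True
        have "\<phi> z / (w - z) - \<phi> z / (w' - z) = \<phi> z * (1 / (w - z) - 1 / (w' - z))"
          by (simp add: algebra_simps)
        then have "norm (\<phi> z / (w - z) - \<phi> z / (w' - z)) =
            norm (\<phi> z) * norm (1 / (w - z) - 1 / (w' - z))"
          by (simp only: norm_mult)
        also have "\<dots> \<le> \<bar>B\<bar> * (2 * sqrt (norm (w - w')) *
            (norm (z - w) powr (-3/2) + norm (z - w') powr (-3/2)))"
          using bd[OF True] by (intro mult_mono cauchy_kernel_Hoelder) auto
        finally show ?thesis using True by (simp add: mult_ac)
      qed simp
    qed
    also have "\<dots> = ?c * ((LINT z|lborel. ?k w z) + (LINT z|lborel. ?k w' z))"
      using K by simp
    also have "\<dots> \<le> ?c * (K + K)"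
      using K by (intro mult_left_mono add_mono) auto
    finally show ?thesis by (simp add: L_def mult_ac)
  qed
  show ?thesis unfolding continuous_on_def
  proof
    fix w assume "w \<in> X"
    have "((\<lambda>x. L * sqrt (norm (x - w))) \<longlongrightarrow> L * sqrt (norm (w - w))) (at w within X)"
      by (intro tendsto_intros)
    then have "((\<lambda>x. L * sqrt (norm (x - w))) \<longlongrightarrow> 0) (at w within X)" by simp
    then have "((\<lambda>x. cauchy_transform S \<phi> x - cauchy_transform S \<phi> w) \<longlongrightarrow> 0) (at w within X)"
      by (rule Lim_null_comparison[rotated]) (use bound in auto)
    then show "(cauchy_transform S \<phi> \<longlongrightarrow> cauchy_transform S \<phi> w) (at w within X)"
      by (simp add: Lim_null[symmetric])
  qed
qed

text \<open>Away from \<open>S\<close> one may differentiate under the integral: the difference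
  quotient of the integrand differs from its derivative by exactly
  \<open>\<phi> z * h / ((w + h - z) * (w - z)^2)\<close>, which is of order \<open>h\<close>
  uniformly in \<open>z\<close>.\<close>

lemma has_field_derivative_cauchy_transform:
  fixes S :: "complex set" and \<phi> :: "complex \<Rightarrow> complex"
  assumes [measurable]: "S \<in> sets borel" and fin: "emeasure lborel S < \<infinity>"
    and [measurable]: "\<phi> \<in> borel_measurable borel" and bd: "\<And>z. z \<in> S \<Longrightarrow> norm (\<phi> z) \<le> B"
    and d: "d > 0" and away: "\<And>z. z \<in> S \<Longrightarrow> d \<le> norm (w - z)"
  shows "(cauchy_transform S \<phi> has_field_derivative - (LINT z:S|lborel. \<phi> z / (w - z)\<^sup>2)) (at w)"
proof -
  have int: "set_integrable lborel S (\<lambda>z. \<phi> z / (w - z))" for w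
    by (rule set_integrable_cauchy_kernel[OF assms(1-4)])
  have S_int: "set_integrable lborel S (\<lambda>z. c)" for c :: complex
    using fin by (simp add: set_integrable_def)
  have int2: "set_integrable lborel S (\<lambda>z. \<phi> z / (w - z)\<^sup>2)"
  proof (rule set_integrable_bound[OF S_int[of "of_real (B / d\<^sup>2)"]])
    show "set_borel_measurable lborel S (\<lambda>z. \<phi> z / (w - z)\<^sup>2)"
      unfolding set_borel_measurable_def by measurable
    have "norm (\<phi> z / (w - z)\<^sup>2) \<le> norm (complex_of_real (B / d\<^sup>2))" if "z \<in> S" for z
    proof -
      have "norm (\<phi> z / (w - z)\<^sup>2) = norm (\<phi> z) / (norm (w - z))\<^sup>2"
        by (simp add: norm_divide norm_power)
      also have "\<dots> \<le> B / d\<^sup>2"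
        using bd[OF that] away[OF that] d by (intro frac_le power_mono order_trans[OF norm_ge_zero bd[OF that]]) auto
      finally show ?thesis by (metis abs_ge_self norm_of_real order_trans)
    qed
    then show "AE z in lborel. z \<in> S \<longrightarrow> norm (\<phi> z / (w - z)\<^sup>2) \<le> norm (complex_of_real (B / d\<^sup>2))"
      by simp
  qed
  \<comment> \<open>For \<open>norm h < d / 2\<close> the remainder has denominator at least
    \<open>(d / 2) * d^2\<close>, whence the factor \<open>2 / d ^ 3\<close>.\<close>
  define M where "M = 2 * \<bar>B\<bar> / d ^ 3 * measure lborel S"
  have bound: "norm ((cauchy_transform S \<phi> (w + h) - cauchy_transform S \<phi> w) / h
      - (- (LINT z:S|lborel. \<phi> z / (w - z)\<^sup>2))) \<le> M * norm h"
    if h: "h \<noteq> 0" "norm h < d / 2" for h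
  proof -
    have "(cauchy_transform S \<phi> (w + h) - cauchy_transform S \<phi> w) / h
        - (- (LINT z:S|lborel. \<phi> z / (w - z)\<^sup>2)) =
        (LINT z:S|lborel. (\<phi> z / (w + h - z) - \<phi> z / (w - z)) / h + \<phi> z / (w - z)\<^sup>2)"
      unfolding cauchy_transform_def
      by (simp add: set_integral_add set_integral_diff int int2 set_integral_divide_zero
          set_integrable_divide)
    also have "norm \<dots> \<le> (LINT z|lborel. indicator S z * (2 * \<bar>B\<bar> / d ^ 3 * norm h))"
      unfolding set_lebesgue_integral_def
    proof (rule Bochner_Integration.integral_norm_bound_integral, goal_cases)
      case 1
      have "set_integrable lborel S (\<lambda>z. (\<phi> z / (w + h - z) - \<phi> z / (w - z)) / h + \<phi> z / (w - z)\<^sup>2)"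
        by (intro set_integral_add set_integral_diff set_integrable_divide int int2)
      then show ?case by (simp add: set_integrable_def)
    next
      case 2
      then show ?case using fin by (intro integrable_mult_left) simp
    next
      case (3 z)
      show ?case
      proof (cases "z \<in> S")
        case True
        have dz: "d \<le> norm (w - z)" by (rule away[OF True])
        have "norm (w - z) \<le> norm (w + h - z) + norm h"
          using norm_triangle_ineq4[of "w + h - z" h] by (simp add: algebra_simps)
        with dz h have dz': "d / 2 \<le> norm (w + h - z)" by simp
        have nz: "w - z \<noteq> 0" "w + h - z \<noteq> 0" using dz dz' d by auto
        have "(\<phi> z / (w + h - z) - \<phi> z / (w - z)) / h + \<phi> z / (w - z)\<^sup>2 =
            \<phi> z * h / ((w + h - z) * (w - z)\<^sup>2)"
          using nz h(1) by (simp add: divide_simps) (simp add: algebra_simps power2_eq_square)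
        also have "norm \<dots> = norm (\<phi> z) * norm h / (norm (w + h - z) * (norm (w - z))\<^sup>2)"
          by (simp add: norm_divide norm_mult norm_power)
        also have "\<dots> \<le> \<bar>B\<bar> * norm h / (d / 2 * d\<^sup>2)"
          using bd[OF True] dz dz' d by (intro frac_le mult_mono power_mono mult_pos_pos) auto
        also have "\<dots> = 2 * \<bar>B\<bar> / d ^ 3 * norm h"
          by (simp add: power2_eq_square power3_eq_cube mult_ac)
        finally show ?thesis using True by simp
      qed simp
    qed
    also have "\<dots> = M * norm h" using fin by (simp add: M_def mult_ac)
    finally show ?thesis .
  qed
  have "((\<lambda>h::complex. M * norm h) \<longlongrightarrow> M * norm (0::complex)) (at 0)"
    by (rule tendsto_mult_left[OF tendsto_norm[OF tendsto_ident_at]])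
  then have lim: "((\<lambda>h::complex. M * norm h) \<longlongrightarrow> 0) (at 0)" by simp
  have "eventually (\<lambda>h. h \<in> ball 0 (d / 2) - {0}) (at (0::complex))"
    using d by (intro eventually_at_in_open) auto
  then have "eventually (\<lambda>h. norm ((cauchy_transform S \<phi> (w + h) - cauchy_transform S \<phi> w) / h
      - (- (LINT z:S|lborel. \<phi> z / (w - z)\<^sup>2))) \<le> M * norm h) (at 0)"
    by eventually_elim (rule bound, auto)
  from Lim_null_comparison[OF this lim] show ?thesis
    unfolding DERIV_def by (rule Lim_null[THEN iffD2])
qed

section \<open>Cauchy--Pompeiu on a rectangle\<close>

lemma contour_integral_linepath_same_Im:
  assumes "Im z = c" "Im z' = c" "Re z = a" "Re z' = b" "a < b"
  shows "contour_integral (linepath z z') f = integral {a..b} (\<lambda>x. f (Complex x c))"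
proof -
  have zz': "z = Complex a c" "z' = Complex b c"
    using assms by (auto simp: complex_eq_iff)
  have "contour_integral (linepath z z') f =
      (z' - z) * integral {0..1} (\<lambda>x. f (linepath z z' x))"
    by (simp add: contour_integral_integral)
  also have "z' - z = of_real (b - a)"
    by (simp add: zz' complex_eq_iff)
  also have "(\<lambda>x. f (linepath z z' x)) = (\<lambda>x. f (Complex (a + (b - a) * x) c))"
    by (intro ext arg_cong[of _ _ f]) (simp add: linepath_def zz' complex_eq_iff algebra_simps)
  also have "integral {0..1} \<dots> =
      integral ((\<lambda>x. x / (b - a)) ` {0..b - a}) (\<lambda>x. f (Complex (a + (b - a) * x) c))"
    using \<open>a < b\<close> by simp
  also have "\<dots> = integral {a - a..b - a} (\<lambda>x. f (Complex (x + a) c)) / of_real (b - a)"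
    using \<open>a < b\<close> by (subst integral_stretch_real) (auto simp: scaleR_conv_of_real add_ac)
  also have "\<dots> = integral {a..b} (\<lambda>x. f (Complex x c)) / of_real (b - a)"
    by (subst integral_shift_real_ivl) (rule refl)
  finally show ?thesis
    using \<open>a < b\<close> by simp
qed

lemma contour_integrable_continuous_rectpath:
  assumes "continuous_on (path_image (rectpath a b)) f"
  shows "f contour_integrable_on rectpath a b"
proof -
  have "continuous_on (closed_segment a (Complex (Re b) (Im a))) f"
    "continuous_on (closed_segment (Complex (Re b) (Im a)) b) f"
    "continuous_on (closed_segment b (Complex (Re a) (Im b))) f"
    "continuous_on (closed_segment (Complex (Re a) (Im b)) a) f"
    by (rule continuous_on_subset[OF assms]; simp add: rectpath_def Let_def path_image_join subset_eq)+
  then show ?thesis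
    by (simp add: rectpath_def Let_def contour_integrable_continuous_linepath
        contour_integrable_joinI valid_path_join)
qed

text \<open>The path runs counterclockwise from the lower left corner \<open>a\<close>, so the top
  and left sides are traversed backwards and enter with a minus sign; vertical sides carry the
  factor \<open>\<i>\<close>.\<close>

lemma contour_integral_rectpath:
  assumes lt: "Re a < Re b" "Im a < Im b" and cont: "continuous_on (path_image (rectpath a b)) f"
  shows "contour_integral (rectpath a b) f =
    integral {Re a..Re b} (\<lambda>x. f (Complex x (Im a))) + \<i> * integral {Im a..Im b} (\<lambda>y. f (Complex (Re b) y))
    - integral {Re a..Re b} (\<lambda>x. f (Complex x (Im b))) - \<i> * integral {Im a..Im b} (\<lambda>y. f (Complex (Re a) y))"
proof -
  define a2 a4 where "a2 = Complex (Re b) (Im a)" and "a4 = Complex (Re a) (Im b)"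
  have rp: "rectpath a b = linepath a a2 +++ linepath a2 b +++ linepath b a4 +++ linepath a4 a"
    by (simp add: rectpath_def a2_def a4_def Let_def)
  have cont': "continuous_on (closed_segment a a2) f" "continuous_on (closed_segment a2 b) f"
    "continuous_on (closed_segment b a4) f" "continuous_on (closed_segment a4 a) f"
    by (rule continuous_on_subset[OF cont]; simp add: rp path_image_join subset_eq)+
  have "contour_integral (rectpath a b) f =
      contour_integral (linepath a a2) f + (contour_integral (linepath a2 b) f +
      (contour_integral (linepath b a4) f + contour_integral (linepath a4 a) f))"
    unfolding rp using cont'
    by (simp add: contour_integrable_continuous_linepath contour_integrable_joinI valid_path_join)
  also have "contour_integral (linepath b a4) f = - contour_integral (linepath a4 b) f"
    by (rule contour_integral_reverse_linepath[OF cont'(3)])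
  also have "contour_integral (linepath a4 a) f = - contour_integral (linepath a a4) f"
    by (rule contour_integral_reverse_linepath[OF cont'(4)])
  also have "contour_integral (linepath a a2) f = integral {Re a..Re b} (\<lambda>x. f (Complex x (Im a)))"
    by (rule contour_integral_linepath_same_Im) (use lt in \<open>auto simp: a2_def\<close>)
  also have "contour_integral (linepath a4 b) f = integral {Re a..Re b} (\<lambda>x. f (Complex x (Im b)))"
    by (rule contour_integral_linepath_same_Im) (use lt in \<open>auto simp: a4_def\<close>)
  also have "contour_integral (linepath a2 b) f = \<i> * integral {Im a..Im b} (\<lambda>y. f (Complex (Re b) y))"
    by (rule contour_integral_linepath_same_Re) (use lt in \<open>auto simp: a2_def\<close>)
  also have "contour_integral (linepath a a4) f = \<i> * integral {Im a..Im b} (\<lambda>y. f (Complex (Re a) y))"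
    by (rule contour_integral_linepath_same_Re) (use lt in \<open>auto simp: a4_def\<close>)
  finally show ?thesis by simp
qed

text \<open>The Leibniz rule applies because the curve \<open>c\<close> stays off \<open>U\<close>.
  It is used for each side of a rectangle, with \<open>U\<close> the open box.\<close>

lemma integral_cauchy_kernel_holomorphic:
  fixes c :: "real \<Rightarrow> complex"
  assumes "convex U" "continuous_on {s..t} c" "continuous_on {s..t} f" "\<And>x. x \<in> {s..t} \<Longrightarrow> c x \<notin> U"
  shows "(\<lambda>w. integral {s..t} (\<lambda>x. f x / (c x - w))) holomorphic_on U"
proof -
  have "(\<lambda>w. integral (cbox s t) (\<lambda>x. f x / (c x - w))) holomorphic_on U"
  proof (rule leibniz_rule_holomorphic[where fx = "\<lambda>w x. f x / (c x - w)\<^sup>2"])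
    fix w x assume w: "w \<in> U" and x: "x \<in> cbox s t"
    then have "c x - w \<noteq> 0" using assms(4)[of x] by auto
    then show "((\<lambda>w. f x / (c x - w)) has_field_derivative f x / (c x - w)\<^sup>2) (at w within U)"
      by (auto intro!: derivative_eq_intros simp: power2_eq_square)
  next
    fix w assume "w \<in> U"
    then show "(\<lambda>x. f x / (c x - w)) integrable_on cbox s t"
      using assms by (intro integrable_continuous continuous_intros) auto
  next
    have "continuous_on (U \<times> cbox s t) (\<lambda>y. c (snd y))" "continuous_on (U \<times> cbox s t) (\<lambda>y. f (snd y))"
      by (rule continuous_on_compose2[of "{s..t}" _ _ snd]; use assms in \<open>auto intro: continuous_intros\<close>)+
    then show "continuous_on (U \<times> cbox s t) (\<lambda>(w, x). f x / (c x - w)\<^sup>2)"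
      unfolding case_prod_unfold using assms(4) by (intro continuous_intros) auto
  qed fact
  then show ?thesis by simp
qed

lemma contour_integral_rectpath_holomorphic:
  assumes lt: "Re a < Re b" "Im a < Im b" and cont: "continuous_on UNIV f"
  shows "(\<lambda>w. contour_integral (rectpath a b) (\<lambda>z. f z / (z - w))) holomorphic_on box a b"
proof -
  have conts: "continuous_on X (\<lambda>x. Complex x y)" "continuous_on X (\<lambda>x. Complex y x)"
    "continuous_on X (\<lambda>x. f (Complex x y))" "continuous_on X (\<lambda>x. f (Complex y x))" for X y
    unfolding Complex_eq by (intro continuous_intros continuous_on_compose2[OF cont]; simp)+
  have "(\<lambda>w. integral {Re a..Re b} (\<lambda>x. f (Complex x (Im a)) / (Complex x (Im a) - w))
      + \<i> * integral {Im a..Im b} (\<lambda>y. f (Complex (Re b) y) / (Complex (Re b) y - w))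
      - integral {Re a..Re b} (\<lambda>x. f (Complex x (Im b)) / (Complex x (Im b) - w))
      - \<i> * integral {Im a..Im b} (\<lambda>y. f (Complex (Re a) y) / (Complex (Re a) y - w))) holomorphic_on box a b"
    by (intro holomorphic_intros integral_cauchy_kernel_holomorphic conts convex_box)
       (auto simp: in_box_complex_iff)
  then show ?thesis
  proof (rule holomorphic_transform)
    fix w assume w: "w \<in> box a b"
    have "path_image (rectpath a b) \<inter> box a b = {}"
      by (rule path_image_rectpath_inter_box) (use lt in auto)
    then have "continuous_on (path_image (rectpath a b)) (\<lambda>z. f z / (z - w))"
      using w by (intro continuous_intros continuous_on_subset[OF cont]) auto
    from contour_integral_rectpath[OF lt this]
    show "integral {Re a..Re b} (\<lambda>x. f (Complex x (Im a)) / (Complex x (Im a) - w))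
      + \<i> * integral {Im a..Im b} (\<lambda>y. f (Complex (Re b) y) / (Complex (Re b) y - w))
      - integral {Re a..Re b} (\<lambda>x. f (Complex x (Im b)) / (Complex x (Im b) - w))
      - \<i> * integral {Im a..Im b} (\<lambda>y. f (Complex (Re a) y) / (Complex (Re a) y - w)) =
      contour_integral (rectpath a b) (\<lambda>z. f z / (z - w))" by simp
  qed
qed

text \<open>The exceptional line is where the integrand may be singular; it does not matter for Fubini.\<close>

lemma rectangle_integral_Re_derivative:
  fixes q qx :: "complex \<Rightarrow> complex"
  assumes lt: "Re a < Re b" "Im a < Im b"
    and qx [measurable]: "qx \<in> borel_measurable borel" and int: "set_integrable lborel (cbox a b) qx"
    and deriv: "\<And>x y. y \<noteq> c \<Longrightarrow> ((\<lambda>x. q (Complex x y)) has_vector_derivative qx (Complex x y)) (at x)"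
    and contx: "\<And>y. y \<noteq> c \<Longrightarrow> continuous_on {Re a..Re b} (\<lambda>x. qx (Complex x y))"
    and contq: "\<And>x. x \<in> {Re a, Re b} \<Longrightarrow> continuous_on {Im a..Im b} (\<lambda>y. q (Complex x y))"
  shows "(LINT z:cbox a b|lborel. qx z) =
    integral {Im a..Im b} (\<lambda>y. q (Complex (Re b) y)) - integral {Im a..Im b} (\<lambda>y. q (Complex (Re a) y))"
proof -
  let ?F = "\<lambda>x y. indicator (cbox a b) (Complex x y) *\<^sub>R qx (Complex x y)"
  have ind: "indicator (cbox a b) (Complex x y) = (indicator {Re a..Re b} x * indicator {Im a..Im b} y :: real)" for x y
    by (auto simp: indicator_def in_cbox_complex_iff)
  have meas: "(\<lambda>z. indicator (cbox a b) z *\<^sub>R qx z) \<in> borel_measurable borel" by measurable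
  have int': "integrable (lborel \<Otimes>\<^sub>M lborel) (\<lambda>(x, y). ?F x y)"
    using int unfolding set_integrable_def integral_complex_eq_pair(2)[OF meas] .
  have qint: "set_integrable lborel {Im a..Im b} (\<lambda>y. q (Complex x y))" if "x \<in> {Re a, Re b}" for x
    by (rule borel_integrable_atLeastAtMost'[OF contq[OF that]])
  have "(LINT z:cbox a b|lborel. qx z) = integral\<^sup>L (lborel \<Otimes>\<^sub>M lborel) (\<lambda>(x, y). ?F x y)"
    unfolding set_lebesgue_integral_def by (rule integral_complex_eq_pair(1)[OF meas])
  also have "\<dots> = (LINT y|lborel. (LINT x|lborel. ?F x y))"
    using lborel_pair.integral_snd[OF int'] by simp
  also have "\<dots> = (LINT y:{Im a..Im b}|lborel. q (Complex (Re b) y) - q (Complex (Re a) y))"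
    unfolding set_lebesgue_integral_def
  proof (rule integral_cong_AE)
    show "(\<lambda>y. LINT x|lborel. ?F x y) \<in> borel_measurable lborel"
      using lborel_pair.integrable_snd[OF int'] by (rule borel_measurable_integrable)
    have "set_integrable lborel {Im a..Im b} (\<lambda>y. q (Complex (Re b) y) - q (Complex (Re a) y))"
      by (intro set_integral_diff qint) auto
    then show "(\<lambda>y. indicator {Im a..Im b} y *\<^sub>R (q (Complex (Re b) y) - q (Complex (Re a) y))) \<in> borel_measurable lborel"
      unfolding set_integrable_def by (rule borel_measurable_integrable)
    have "AE y in lborel. y \<noteq> c" by (rule AE_lborel_singleton)
    then show "AE y in lborel. (LINT x|lborel. ?F x y) =
        indicator {Im a..Im b} y *\<^sub>R (q (Complex (Re b) y) - q (Complex (Re a) y))"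
    proof eventually_elim
      case (elim y)
      have "(LINT x|lborel. ?F x y) =
          indicator {Im a..Im b} y *\<^sub>R (LINT x|lborel. indicator {Re a..Re b} x *\<^sub>R qx (Complex x y))"
        by (subst integral_scaleR_right[symmetric]) (simp add: ind mult.commute)
      also have "(LINT x|lborel. indicator {Re a..Re b} x *\<^sub>R qx (Complex x y)) =
          q (Complex (Re b) y) - q (Complex (Re a) y)"
        by (rule integral_FTC_Icc)
           (use lt deriv[OF elim] contx[OF elim] in \<open>auto intro: has_vector_derivative_at_within\<close>)
      finally show ?case .
    qed
  qed
  also have "\<dots> = (LINT y:{Im a..Im b}|lborel. q (Complex (Re b) y)) - (LINT y:{Im a..Im b}|lborel. q (Complex (Re a) y))"
    by (intro set_integral_diff qint) auto
  finally show ?thesis using qint by (simp add: set_borel_integral_eq_integral(2))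
qed

text \<open>Mirror image of the previous lemma: the inner integral now runs in the imaginary
  direction, and the exceptional line is vertical.\<close>

lemma rectangle_integral_Im_derivative:
  fixes q qy :: "complex \<Rightarrow> complex"
  assumes lt: "Re a < Re b" "Im a < Im b"
    and qy [measurable]: "qy \<in> borel_measurable borel" and int: "set_integrable lborel (cbox a b) qy"
    and deriv: "\<And>x y. x \<noteq> c \<Longrightarrow> ((\<lambda>y. q (Complex x y)) has_vector_derivative qy (Complex x y)) (at y)"
    and contx: "\<And>x. x \<noteq> c \<Longrightarrow> continuous_on {Im a..Im b} (\<lambda>y. qy (Complex x y))"
    and contq: "\<And>y. y \<in> {Im a, Im b} \<Longrightarrow> continuous_on {Re a..Re b} (\<lambda>x. q (Complex x y))"
  shows "(LINT z:cbox a b|lborel. qy z) =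
    integral {Re a..Re b} (\<lambda>x. q (Complex x (Im b))) - integral {Re a..Re b} (\<lambda>x. q (Complex x (Im a)))"
proof -
  let ?F = "\<lambda>x y. indicator (cbox a b) (Complex x y) *\<^sub>R qy (Complex x y)"
  have ind: "indicator (cbox a b) (Complex x y) = (indicator {Re a..Re b} x * indicator {Im a..Im b} y :: real)" for x y
    by (auto simp: indicator_def in_cbox_complex_iff)
  have meas: "(\<lambda>z. indicator (cbox a b) z *\<^sub>R qy z) \<in> borel_measurable borel" by measurable
  have int': "integrable (lborel \<Otimes>\<^sub>M lborel) (\<lambda>(x, y). ?F x y)"
    using int unfolding set_integrable_def integral_complex_eq_pair(2)[OF meas] .
  have qint: "set_integrable lborel {Re a..Re b} (\<lambda>x. q (Complex x y))" if "y \<in> {Im a, Im b}" for y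
    by (rule borel_integrable_atLeastAtMost'[OF contq[OF that]])
  have "(LINT z:cbox a b|lborel. qy z) = integral\<^sup>L (lborel \<Otimes>\<^sub>M lborel) (\<lambda>(x, y). ?F x y)"
    unfolding set_lebesgue_integral_def by (rule integral_complex_eq_pair(1)[OF meas])
  also have "\<dots> = (LINT x|lborel. (LINT y|lborel. ?F x y))"
    using lborel_pair.integral_fst[OF int'] by simp
  also have "\<dots> = (LINT x:{Re a..Re b}|lborel. q (Complex x (Im b)) - q (Complex x (Im a)))"
    unfolding set_lebesgue_integral_def
  proof (rule integral_cong_AE)
    show "(\<lambda>x. LINT y|lborel. ?F x y) \<in> borel_measurable lborel"
      using lborel_pair.integrable_fst[OF int'] by (rule borel_measurable_integrable)
    have "set_integrable lborel {Re a..Re b} (\<lambda>x. q (Complex x (Im b)) - q (Complex x (Im a)))"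
      by (intro set_integral_diff qint) auto
    then show "(\<lambda>x. indicator {Re a..Re b} x *\<^sub>R (q (Complex x (Im b)) - q (Complex x (Im a)))) \<in> borel_measurable lborel"
      unfolding set_integrable_def by (rule borel_measurable_integrable)
    have "AE x in lborel. x \<noteq> c" by (rule AE_lborel_singleton)
    then show "AE x in lborel. (LINT y|lborel. ?F x y) =
        indicator {Re a..Re b} x *\<^sub>R (q (Complex x (Im b)) - q (Complex x (Im a)))"
    proof eventually_elim
      case (elim x)
      have "(LINT y|lborel. ?F x y) =
          indicator {Re a..Re b} x *\<^sub>R (LINT y|lborel. indicator {Im a..Im b} y *\<^sub>R qy (Complex x y))"
        by (subst integral_scaleR_right[symmetric]) (simp add: ind)
      also have "(LINT y|lborel. indicator {Im a..Im b} y *\<^sub>R qy (Complex x y)) =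
          q (Complex x (Im b)) - q (Complex x (Im a))"
        by (rule integral_FTC_Icc)
           (use lt deriv[OF elim] contx[OF elim] in \<open>auto intro: has_vector_derivative_at_within\<close>)
      finally show ?case .
    qed
  qed
  also have "\<dots> = (LINT x:{Re a..Re b}|lborel. q (Complex x (Im b))) - (LINT x:{Re a..Re b}|lborel. q (Complex x (Im a)))"
    by (intro set_integral_diff qint) auto
  finally show ?thesis using qint by (simp add: set_borel_integral_eq_integral(2))
qed

text \<open>Green's formula on a rectangle for \<open>q z = (cnj z ^ p - cnj w ^ p) / (z - w)\<close>, whose
  singularity at \<open>w\<close> is bounded, so that no neighbourhood of \<open>w\<close> has to be excised.\<close>

lemma cauchy_transform_cbox_cnj_power:
  assumes lt: "Re a < Re b" "Im a < Im b" and w: "w \<in> box a b" and p: "p \<ge> 1"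
  shows "cauchy_transform (cbox a b) (\<lambda>z. cnj z ^ (p - 1)) w =
    of_real pi * cnj w ^ p / of_nat p +
    \<i> / (2 * of_nat p) * contour_integral (rectpath a b) (\<lambda>z. cnj z ^ p / (z - w))"
proof -
  define P :: complex where "P = of_nat p"
  have P: "P \<noteq> 0" using p by (simp add: P_def)
  \<comment> \<open>The cofactor in \<open>cnj z ^ p - cnj w ^ p = cnj (z - w) * S z\<close>. As
    \<open>cnj (z - w) / (z - w)\<close> has modulus at most 1, it shows that \<open>q\<close> is
    bounded near \<open>w\<close>.\<close>
  define S where "S = (\<lambda>z. \<Sum>i<p. cnj w ^ (p - Suc i) * cnj z ^ i)"
  define q where "q = (\<lambda>z. (cnj z ^ p - cnj w ^ p) / (z - w))"
  \<comment> \<open>\<open>qx\<close> and \<open>qy\<close> are the partial derivatives of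
    \<open>q\<close> away from \<open>w\<close>, by the quotient rule with \<open>cnj z\<close>
    having partial derivatives 1 and \<open>- \<i>\<close>.\<close>
  define qx where "qx = (\<lambda>z. (P * cnj z ^ (p - 1) * (z - w) - (cnj z ^ p - cnj w ^ p)) / (z - w)\<^sup>2)"
  define qy where "qy = (\<lambda>z. - \<i> * (P * cnj z ^ (p - 1) * (z - w) + (cnj z ^ p - cnj w ^ p)) / (z - w)\<^sup>2)"
  \<comment> \<open>The partial derivatives are Cauchy kernels \<open>\<phi>1 z / (w - z)\<close>
    and \<open>\<phi>2 z / (w - z)\<close> with bounded numerators, hence integrable over the
    rectangle.\<close>
  define \<phi>1 where "\<phi>1 = (\<lambda>z. cnj (z - w) / (z - w) * S z - P * cnj z ^ (p - 1))"
  define \<phi>2 where "\<phi>2 = (\<lambda>z. \<i> * (P * cnj z ^ (p - 1) + cnj (z - w) / (z - w) * S z))"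
  have factor: "cnj z ^ p - cnj w ^ p = cnj (z - w) * S z" for z
    unfolding S_def complex_cnj_diff by (rule power_diff_sumr2)
  have qx_eq: "qx z = \<phi>1 z / (w - z)" for z
  proof (cases "z = w")
    case False
    then have "w - z \<noteq> 0" "z - w \<noteq> 0" by auto
    then show ?thesis unfolding qx_def \<phi>1_def factor
      by (simp add: divide_simps power2_eq_square) (simp add: algebra_simps)
  qed (simp add: qx_def)
  have qy_eq: "qy z = \<phi>2 z / (w - z)" for z
  proof (cases "z = w")
    case False
    then have "w - z \<noteq> 0" "z - w \<noteq> 0" by auto
    then show ?thesis unfolding qy_def \<phi>2_def factor
      by (simp add: divide_simps power2_eq_square) (simp add: algebra_simps)
  qed (simp add: qy_def)
  have [measurable]: "cnj \<in> borel_measurable borel"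
    by (intro borel_measurable_continuous_onI continuous_intros)
  have Sm [measurable]: "S \<in> borel_measurable borel"
    unfolding S_def by (intro borel_measurable_continuous_onI continuous_intros)
  have "compact ((\<lambda>z. \<bar>norm (S z)\<bar> + norm (P * cnj z ^ (p - 1))) ` cbox a b)"
    unfolding S_def by (intro compact_continuous_image continuous_intros compact_cbox)
  then obtain B where B: "\<And>z. z \<in> cbox a b \<Longrightarrow> norm (S z) + norm (P * cnj z ^ (p - 1)) \<le> B"
    by (force dest!: compact_imp_bounded simp: bounded_iff)
  have sig: "norm (cnj (z - w) / (z - w) * S z) \<le> norm (S z)" for z
  proof -
    have "norm (cnj (z - w) / (z - w)) \<le> 1" unfolding norm_divide complex_mod_cnj by simp
    then show ?thesis using mult_right_mono[of _ 1 "norm (S z)"] by (simp only: norm_mult) simp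
  qed
  have bd1: "norm (\<phi>1 z) \<le> B" if "z \<in> cbox a b" for z
    using norm_triangle_ineq4[of "cnj (z - w) / (z - w) * S z" "P * cnj z ^ (p - 1)"] sig[of z] B[OF that]
    unfolding \<phi>1_def by linarith
  have bd2: "norm (\<phi>2 z) \<le> B" if "z \<in> cbox a b" for z
    using norm_triangle_ineq[of "P * cnj z ^ (p - 1)" "cnj (z - w) / (z - w) * S z"] sig[of z] B[OF that]
    unfolding \<phi>2_def norm_mult[of \<i>] by (simp del: complex_cnj_diff)
  have fin: "emeasure lborel (cbox a b) < \<infinity>" by (intro emeasure_bounded_finite bounded_cbox)
  have intx: "set_integrable lborel (cbox a b) qx"
    unfolding qx_eq by (rule set_integrable_cauchy_kernel[OF _ fin _ bd1]) (auto simp: \<phi>1_def)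
  have inty: "set_integrable lborel (cbox a b) qy"
    unfolding qy_eq by (rule set_integrable_cauchy_kernel[OF _ fin _ bd2]) (auto simp: \<phi>2_def)
  have contq: "continuous_on X q" if "w \<notin> X" for X
    unfolding q_def using that by (intro continuous_intros) auto
  have contqx: "continuous_on X qx" if "w \<notin> X" for X
    unfolding qx_def using that by (intro continuous_intros) auto
  have contqy: "continuous_on X qy" if "w \<notin> X" for X
    unfolding qy_def using that by (intro continuous_intros) auto
  have contC: "continuous_on X (\<lambda>x. Complex x y)" "continuous_on X (\<lambda>x. Complex y x)" for X y
    unfolding Complex_eq by (intro continuous_intros)+
  have X: "(LINT z:cbox a b|lborel. qx z) =
      integral {Im a..Im b} (\<lambda>y. q (Complex (Re b) y)) - integral {Im a..Im b} (\<lambda>y. q (Complex (Re a) y))"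
  proof (rule rectangle_integral_Re_derivative[OF lt _ intx, where c = "Im w"])
    show "qx \<in> borel_measurable borel" unfolding qx_def by measurable
    show "((\<lambda>x. q (Complex x y)) has_vector_derivative qx (Complex x y)) (at x)" if "y \<noteq> Im w" for x y
    proof -
      have nz: "of_real x + \<i> * of_real y - w \<noteq> 0" using that by (auto simp: complex_eq_iff)
      \<comment> \<open>For fixed \<open>y\<close>, replacing the real \<open>x\<close> by a complex
        \<open>\<zeta>\<close> turns \<open>cnj z\<close> into the holomorphic
        \<open>\<zeta> - \<i> * y\<close>; the complex derivative at a real point is then the wanted
        partial derivative.\<close>
      have "((\<lambda>\<zeta>. ((\<zeta> - \<i> * of_real y) ^ p - cnj w ^ p) / (\<zeta> + \<i> * of_real y - w))
          has_field_derivative qx (Complex x y)) (at (of_real x))"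
        using nz unfolding qx_def
        by (auto intro!: derivative_eq_intros simp: Complex_eq P_def power2_eq_square)
      from has_vector_derivative_real_field[OF this] show ?thesis
        by (simp add: q_def Complex_eq)
    qed
    show "continuous_on {Re a..Re b} (\<lambda>x. qx (Complex x y))" if "y \<noteq> Im w" for y
      using that by (intro continuous_on_compose2[OF contqx contC(1) order_refl]) auto
    show "continuous_on {Im a..Im b} (\<lambda>y. q (Complex x y))" if "x \<in> {Re a, Re b}" for x
      using that w by (intro continuous_on_compose2[OF contq contC(2) order_refl])
        (auto simp: in_box_complex_iff)
  qed
  have Y: "(LINT z:cbox a b|lborel. qy z) =
      integral {Re a..Re b} (\<lambda>x. q (Complex x (Im b))) - integral {Re a..Re b} (\<lambda>x. q (Complex x (Im a)))"
  proof (rule rectangle_integral_Im_derivative[OF lt _ inty, where c = "Re w"])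
    show "qy \<in> borel_measurable borel" unfolding qy_def by measurable
    show "((\<lambda>y. q (Complex x y)) has_vector_derivative qy (Complex x y)) (at y)" if "x \<noteq> Re w" for x y
    proof -
      have nz: "of_real x + \<i> * of_real y - w \<noteq> 0" using that by (auto simp: complex_eq_iff)
      have "((\<lambda>\<zeta>. ((of_real x - \<i> * \<zeta>) ^ p - cnj w ^ p) / (of_real x + \<i> * \<zeta> - w))
          has_field_derivative qy (Complex x y)) (at (of_real y))"
        using nz unfolding qy_def
        by (auto intro!: derivative_eq_intros simp: Complex_eq P_def power2_eq_square algebra_simps)
      from has_vector_derivative_real_field[OF this] show ?thesis
        by (simp add: q_def Complex_eq)
    qed
    show "continuous_on {Im a..Im b} (\<lambda>y. qy (Complex x y))" if "x \<noteq> Re w" for x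
      using that by (intro continuous_on_compose2[OF contqy contC(2) order_refl]) auto
    show "continuous_on {Re a..Re b} (\<lambda>x. q (Complex x y))" if "y \<in> {Im a, Im b}" for y
      using that w by (intro continuous_on_compose2[OF contq contC(1) order_refl])
        (auto simp: in_box_complex_iff)
  qed
  have w_path: "w \<notin> path_image (rectpath a b)"
    using path_image_rectpath_inter_box[of a b] lt w by auto
  \<comment> \<open>The combination \<open>qx + \<i> * qy\<close> is twice the d-bar derivative of
    \<open>q\<close>, namely \<open>2 * P * cnj z ^ (p - 1) / (z - w)\<close>; at
    \<open>z = w\<close> both integrands are 0.\<close>
  have "cauchy_transform (cbox a b) (\<lambda>z. cnj z ^ (p - 1)) w =
      (LINT z:cbox a b|lborel. - (1 / (2 * P)) * (qx z + \<i> * qy z))"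
    unfolding cauchy_transform_def
  proof (rule set_lebesgue_integral_cong)
    show "\<forall>z. z \<in> cbox a b \<longrightarrow> cnj z ^ (p - 1) / (w - z) = - (1 / (2 * P)) * (qx z + \<i> * qy z)"
      using P by (simp add: qx_eq qy_eq \<phi>1_def \<phi>2_def add_divide_distrib[symmetric] del: complex_cnj_diff)
  qed simp
  also have "\<dots> = - (1 / (2 * P)) * ((LINT z:cbox a b|lborel. qx z) + \<i> * (LINT z:cbox a b|lborel. qy z))"
    using intx inty
    by (simp only: set_integral_mult_right set_integral_add set_integrable_mult_right)
  also have "(LINT z:cbox a b|lborel. qx z) + \<i> * (LINT z:cbox a b|lborel. qy z) =
      - \<i> * contour_integral (rectpath a b) q"
    unfolding X Y contour_integral_rectpath[OF lt contq[OF w_path]] by (simp add: algebra_simps)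
  also have "contour_integral (rectpath a b) q =
      contour_integral (rectpath a b) (\<lambda>z. cnj z ^ p / (z - w) - cnj w ^ p * (1 / (z - w)))"
    unfolding q_def by (simp add: diff_divide_distrib)
  also have "\<dots> = contour_integral (rectpath a b) (\<lambda>z. cnj z ^ p / (z - w)) -
      cnj w ^ p * contour_integral (rectpath a b) (\<lambda>z. 1 / (z - w))"
  proof -
    have "continuous_on (path_image (rectpath a b)) (\<lambda>z. cnj z ^ p / (z - w))"
      "continuous_on (path_image (rectpath a b)) (\<lambda>z. 1 / (z - w))"
      using w_path by (intro continuous_intros; auto)+
    note * = this[THEN contour_integrable_continuous_rectpath]
    show ?thesis
      unfolding contour_integral_diff[OF *(1) contour_integrable_lmul[OF *(2)]]
        contour_integral_lmul[OF *(2)] ..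
  qed
  \<comment> \<open>The path winds once around \<open>w\<close>; this residue term is the source of
    \<open>pi * cnj w ^ p / p\<close>.\<close>
  also have "contour_integral (rectpath a b) (\<lambda>z. 1 / (z - w)) = 2 * of_real pi * \<i>"
    using winding_number_rectpath[OF w] winding_number_valid_path[OF valid_path_rectpath w_path]
    by (simp add: divide_simps)
  finally show ?thesis using P unfolding P_def[symmetric] by (simp add: field_simps)
qed

text \<open>A local argument: split \<open>\<Omega>\<close> into a closed rectangle around the point
  and the rest. The rest contributes a function holomorphic in the open rectangle, and the rectangle
  contributes the subtracted term plus a holomorphic contour integral.\<close>

lemma cauchy_transform_cnj_power_holomorphic:
  assumes op: "open \<Omega>" and bdd: "bounded \<Omega>" and p: "p \<ge> 1"
  shows "(\<lambda>w. cauchy_transform \<Omega> (\<lambda>z. cnj z ^ (p - 1)) w - of_real pi * cnj w ^ p / of_nat p)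
    holomorphic_on \<Omega>"
  unfolding holomorphic_on_open[OF op]
proof
  fix w0 assume "w0 \<in> \<Omega>"
  obtain a b where ab: "cbox a b \<subseteq> \<Omega>" "w0 \<in> box a b"
    using open_contains_cbox[OF op \<open>w0 \<in> \<Omega>\<close>] by metis
  then have lt: "Re a < Re b" "Im a < Im b" by (auto simp: in_box_complex_iff)
  let ?\<phi> = "\<lambda>z. cnj z ^ (p - 1)" and ?S = "\<Omega> - cbox a b"
  obtain M where M: "\<And>z. z \<in> \<Omega> \<Longrightarrow> norm z \<le> M"
    using bdd by (auto simp: bounded_iff)
  have bd: "norm (?\<phi> z) \<le> M ^ (p - 1)" if "z \<in> \<Omega>" for z
    using M[OF that] by (simp add: norm_power power_mono)
  have meas: "?\<phi> \<in> borel_measurable borel"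
    by (intro borel_measurable_continuous_onI continuous_intros)
  have fin: "emeasure lborel A < \<infinity>" if "A \<subseteq> \<Omega>" for A
    using bounded_subset[OF bdd that] by (rule emeasure_bounded_finite)
  have S: "?S \<in> sets borel" using op by auto
  have split: "cauchy_transform \<Omega> ?\<phi> w = cauchy_transform (cbox a b) ?\<phi> w + cauchy_transform ?S ?\<phi> w" for w
  proof -
    have "set_integrable lborel A (\<lambda>z. ?\<phi> z / (w - z))" if "A \<subseteq> \<Omega>" "A \<in> sets borel" for A
      using set_integrable_cauchy_kernel[OF that(2) fin[OF that(1)] meas] bd that by blast
    then have "(LINT z:cbox a b \<union> ?S|lborel. ?\<phi> z / (w - z)) =
        cauchy_transform (cbox a b) ?\<phi> w + cauchy_transform ?S ?\<phi> w"
      unfolding cauchy_transform_def using ab S by (intro set_integral_Un) auto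
    moreover have "cbox a b \<union> ?S = \<Omega>" using ab by auto
    ultimately show ?thesis by (simp add: cauchy_transform_def)
  qed
  have "cauchy_transform ?S ?\<phi> holomorphic_on box a b"
    unfolding holomorphic_on_open[OF open_box]
  proof
    fix w assume "w \<in> box a b"
    then obtain d where d: "d > 0" "ball w d \<subseteq> box a b" using open_contains_ball[of "box a b"] by auto
    then have "ball w d \<subseteq> cbox a b" using box_subset_cbox by blast
    then have "d \<le> norm (w - z)" if "z \<in> ?S" for z
      using that by (force simp: dist_norm)
    then show "\<exists>f'. (cauchy_transform ?S ?\<phi> has_field_derivative f') (at w)"
      using has_field_derivative_cauchy_transform[OF S fin meas _ d(1)] bd by blast
  qed
  moreover have "(\<lambda>w. contour_integral (rectpath a b) (\<lambda>z. cnj z ^ p / (z - w))) holomorphic_on box a b"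
    by (intro contour_integral_rectpath_holomorphic lt continuous_intros)
  ultimately have "(\<lambda>w. \<i> / (2 * of_nat p) * contour_integral (rectpath a b) (\<lambda>z. cnj z ^ p / (z - w)) +
      cauchy_transform ?S ?\<phi> w) holomorphic_on box a b"
    by (intro holomorphic_intros)
  then have "(\<lambda>w. cauchy_transform \<Omega> ?\<phi> w - of_real pi * cnj w ^ p / of_nat p) holomorphic_on box a b"
  proof (rule holomorphic_transform)
    fix w assume w: "w \<in> box a b"
    show "\<i> / (2 * of_nat p) * contour_integral (rectpath a b) (\<lambda>z. cnj z ^ p / (z - w)) +
        cauchy_transform ?S ?\<phi> w = cauchy_transform \<Omega> ?\<phi> w - of_real pi * cnj w ^ p / of_nat p"
      unfolding split cauchy_transform_cbox_cnj_power[OF lt w p] by simp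
  qed
  then show "\<exists>f'. ((\<lambda>w. cauchy_transform \<Omega> ?\<phi> w - of_real pi * cnj w ^ p / of_nat p)
      has_field_derivative f') (at w0)"
    using ab(2) unfolding holomorphic_on_open[OF open_box] by blast
qed

section \<open>The quadrature identity tested on Cauchy kernels\<close>

lemma A_infinity_if_holomorphic_near_closure:
  assumes "f holomorphic_on S" "open S" "closure \<Omega> \<subseteq> S"
  shows "f \<in> A_infinity \<Omega>"
proof -
  have "continuous_on (closure \<Omega>) ((deriv ^^ n) f)" for n
    using holomorphic_higher_deriv[OF assms(1,2), of n] assms(3)
    by (meson continuous_on_subset holomorphic_on_imp_continuous_on)
  moreover have "f holomorphic_on \<Omega>"
    using assms closure_subset by (meson holomorphic_on_subset order_trans)
  ultimately show ?thesis unfolding A_infinity_def by blast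
qed

text \<open>The weight factors as \<open>z ^ (p - 1) * cnj z ^ (p - 1)\<close>. A test function with
  \<open>z ^ (p - 1)\<close> in the denominator removes the holomorphic half; its possible poles 0
  and \<open>w\<close> lie outside the closure.\<close>

lemma cauchy_transform_exterior:
  assumes op: "open \<Omega>" and nz: "0 \<notin> closure \<Omega>"
    and quad: "\<And>f. f \<in> A_infinity \<Omega> \<Longrightarrow>
      (LINT z:\<Omega>|lebesgue. f z * complex_of_real (norm z ^ (2 * p - 2))) = c * f z0"
    and w: "w \<notin> closure \<Omega>"
  shows "cauchy_transform \<Omega> (\<lambda>z. cnj z ^ (p - 1)) w = c / z0 ^ (p - 1) / (w - z0)"
proof -
  let ?f = "\<lambda>z. 1 / (z ^ (p - 1) * (w - z))"
  have "?f holomorphic_on (- {0, w})"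
    by (intro holomorphic_intros) auto
  then have "?f \<in> A_infinity \<Omega>"
    by (rule A_infinity_if_holomorphic_near_closure)
       (use nz w in \<open>auto intro!: open_Compl finite_imp_closed\<close>)
  then have "c * ?f z0 = (LINT z:\<Omega>|lebesgue. ?f z * complex_of_real (norm z ^ (2 * p - 2)))"
    by (rule quad[symmetric])
  also have "\<dots> = (LINT z:\<Omega>|lebesgue. cnj z ^ (p - 1) / (w - z))"
  proof (rule set_lebesgue_integral_cong)
    show "\<Omega> \<in> sets lebesgue" using op by auto
    show "\<forall>z. z \<in> \<Omega> \<longrightarrow> ?f z * complex_of_real (norm z ^ (2 * p - 2)) = cnj z ^ (p - 1) / (w - z)"
    proof (intro allI impI)
      fix z assume "z \<in> \<Omega>"
      then have "z \<noteq> 0" using nz closure_subset by blast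
      have "norm z ^ (2 * p - 2) = ((norm z)\<^sup>2) ^ (p - 1)"
        by (simp add: power_mult[symmetric] right_diff_distrib')
      then have "complex_of_real (norm z ^ (2 * p - 2)) = (complex_of_real ((norm z)\<^sup>2)) ^ (p - 1)"
        by simp
      also have "\<dots> = z ^ (p - 1) * cnj z ^ (p - 1)"
        by (simp only: complex_norm_square power_mult_distrib)
      finally show "?f z * complex_of_real (norm z ^ (2 * p - 2)) = cnj z ^ (p - 1) / (w - z)"
        using \<open>z \<noteq> 0\<close> by simp
    qed
  qed
  also have "\<dots> = cauchy_transform \<Omega> (\<lambda>z. cnj z ^ (p - 1)) w"
  proof -
    have [measurable]: "\<Omega> \<in> sets borel" "cnj \<in> borel_measurable borel"
      using op by (auto intro!: borel_measurable_continuous_onI continuous_intros)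
    \<comment> \<open>The integrand is Borel, so completing the measure does not change the
      integral.\<close>
    show ?thesis
      unfolding cauchy_transform_def set_lebesgue_integral_def
      by (rule integral_completion) measurable
  qed
  finally show ?thesis by simp
qed

section \<open>Boundary values and the lemniscate\<close>

lemma power_not_constant_on_open:
  fixes X :: "complex set"
  assumes "open X" "X \<noteq> {}" "p \<ge> 1"
  shows "\<not> (\<lambda>z. z ^ p) constant_on X"
proof
  assume "(\<lambda>z. z ^ p) constant_on X"
  then obtain c where "X \<subseteq> {z. z ^ p = c}" by (auto simp: constant_on_def)
  moreover have "finite {z. z ^ p = c}" using assms(3) by (intro finite_nth_roots) auto
  ultimately show False using assms(1,2) finite_imp_not_open finite_subset by blast
qed

text \<open>The power map sends \<open>\<Omega>\<close> onto the disc of radius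
  \<open>\<rho>\<close> about \<open>z0 ^ p\<close>. This disc avoids 0, so it carries a branch
  \<open>g\<close> of the root with \<open>g (z0 ^ p) = z0\<close>, and connectedness shows that
  \<open>g\<close> inverts the power map on \<open>\<Omega>\<close>.\<close>

lemma pth_root_of_disc_if_frontier_lemniscate:
  fixes p :: nat and \<Omega> :: "complex set"
  assumes p: "p \<ge> 1" and op: "open \<Omega>" and con: "connected \<Omega>" and bdd: "bounded \<Omega>"
    and nz: "0 \<notin> closure \<Omega>" and z0: "z0 \<in> \<Omega>"
    and fr: "\<And>w. w \<in> frontier \<Omega> \<Longrightarrow> norm (w ^ p - z0 ^ p) = \<rho>"
  shows "is_pth_root_of_disc p \<Omega>"
proof -
  define a where "a = z0 ^ p"
  have z0nz: "z0 \<noteq> 0" using nz z0 closure_subset by blast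
  have anz: "a \<noteq> 0" using z0nz by (simp add: a_def)
  have compact_cl: "compact (closure \<Omega>)" using bdd by simp
  have le: "norm (z ^ p - a) \<le> \<rho>" if "z \<in> \<Omega>" for z
  proof (rule maximum_modulus_frontier[of "\<lambda>z. z ^ p - a" \<Omega>])
    show "(\<lambda>z. z ^ p - a) holomorphic_on interior \<Omega>" by (intro holomorphic_intros)
    show "continuous_on (closure \<Omega>) (\<lambda>z. z ^ p - a)" by (intro continuous_intros)
  qed (use bdd fr that in \<open>auto simp: a_def\<close>)
  \<comment> \<open>Equality at an interior point would make \<open>z ^ p\<close> constant on an
    open set, although its fibres are finite.\<close>
  have less: "norm (z ^ p - a) < \<rho>" if z: "z \<in> \<Omega>" for z
  proof (rule ccontr)
    assume "\<not> ?thesis"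
    with le[OF z] have eq: "norm (z ^ p - a) = \<rho>" by simp
    have "(\<lambda>z. z ^ p - a) constant_on \<Omega>"
      by (rule maximum_modulus_principle[of _ \<Omega> \<Omega> z])
         (use op con z le eq in \<open>auto intro!: holomorphic_intros\<close>)
    then obtain c where "\<And>x. x \<in> \<Omega> \<Longrightarrow> x ^ p = c + a"
      by (auto simp: constant_on_def algebra_simps)
    then have "(\<lambda>z. z ^ p) constant_on \<Omega>" by (auto simp: constant_on_def)
    with power_not_constant_on_open[OF op _ p] z show False by auto
  qed
  \<comment> \<open>Otherwise the disc contains a frontier point \<open>b\<close> of the image. By
    compactness \<open>b = w ^ p\<close> with \<open>w\<close> in the closure; \<open>w\<close> is
    not on the frontier, as \<open>b\<close> lies strictly inside the disc, so the open mapping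
    theorem makes \<open>b\<close> interior.\<close>
  have img: "(\<lambda>z. z ^ p) ` \<Omega> = ball a \<rho>"
  proof (rule ccontr)
    let ?P = "(\<lambda>z. z ^ p) ` \<Omega>"
    assume neq: "?P \<noteq> ball a \<rho>"
    have sub: "?P \<subseteq> ball a \<rho>"
      using less by (auto simp: dist_norm norm_minus_commute)
    have ne: "?P \<noteq> {}" using z0 by auto
    have fne: "ball a \<rho> \<inter> frontier ?P \<noteq> {}"
      by (rule connected_Int_frontier) (use sub neq ne in auto)
    then obtain b where b: "b \<in> ball a \<rho>" "b \<in> closure ?P" "b \<notin> interior ?P"
      by (auto simp: frontier_def)
    have "closed ((\<lambda>z. z ^ p) ` closure \<Omega>)"
      by (intro compact_imp_closed compact_continuous_image compact_cl continuous_intros)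
    then have "closure ?P \<subseteq> (\<lambda>z. z ^ p) ` closure \<Omega>"
      by (intro closure_minimal) (use closure_subset in auto)
    then obtain w where w: "w \<in> closure \<Omega>" "b = w ^ p" using b by auto
    have "w \<notin> frontier \<Omega>" using fr[of w] b w by (auto simp: a_def dist_norm norm_minus_commute)
    then have "w \<in> \<Omega>" using w op by (auto simp: frontier_def interior_open)
    have "open ?P"
      by (rule open_mapping_thm2[of "\<lambda>z. z ^ p" \<Omega>])
         (use op p power_not_constant_on_open in \<open>auto intro!: holomorphic_intros\<close>)
    with b \<open>w \<in> \<Omega>\<close> w show False by (auto simp: interior_open)
  qed
  have rpos: "0 < \<rho>" using less[OF z0] norm_ge_zero le_less_trans by blast
  \<comment> \<open>If not, 0 lies in the closed disc, which is covered by the image of the compact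
    closure of \<open>\<Omega>\<close>; then 0 itself is in that closure.\<close>
  have "\<rho> < norm a"
  proof (rule ccontr)
    assume "\<not> ?thesis"
    then have "0 \<in> closure (ball a \<rho>)" using rpos by (simp add: dist_norm)
    also have "closed ((\<lambda>z. z ^ p) ` closure \<Omega>)"
      by (intro compact_imp_closed compact_continuous_image compact_cl continuous_intros)
    then have "closure (ball a \<rho>) \<subseteq> (\<lambda>z. z ^ p) ` closure \<Omega>"
      unfolding img[symmetric] by (intro closure_minimal) (use closure_subset in auto)
    finally show False using nz p by auto
  qed
  have re_pos: "Re (z / a) > 0" if z: "z \<in> ball a \<rho>" for z
  proof -
    have "norm (z / a - 1) = norm (z - a) / norm a"
      using anz by (simp add: norm_divide[symmetric] divide_simps)
    also have "\<dots> < 1" using z \<open>\<rho> < norm a\<close> anz by (simp add: dist_norm norm_minus_commute)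
    finally have "norm (z / a - 1) < 1" .
    with abs_Re_le_cmod[of "z / a - 1"] show ?thesis by simp
  qed
  \<comment> \<open>Dividing by \<open>a\<close> moves the disc into the right half-plane, off the
    branch cut of \<open>Ln\<close>; the factor \<open>z0\<close> selects the branch with
    \<open>g a = z0\<close>.\<close>
  define g where "g = (\<lambda>z. z0 * exp (Ln (z / a) / of_nat p))"
  have notin: "z / a \<notin> \<real>\<^sub>\<le>\<^sub>0" if "z \<in> ball a \<rho>" for z
    using re_pos[OF that] by (auto simp: complex_nonpos_Reals_iff)
  have g_hol: "g holomorphic_on ball a \<rho>"
    unfolding g_def using notin anz p by (auto intro!: holomorphic_intros)
  have g_pow: "g z ^ p = z" if "z \<in> ball a \<rho>" for z
  proof -
    have "z / a \<noteq> 0" using notin[OF that] by auto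
    then show ?thesis using p anz
      by (simp add: g_def power_mult_distrib a_def[symmetric] exp_of_nat_mult[symmetric])
  qed
  have g_a: "g a = z0" using anz by (simp add: g_def)
  \<comment> \<open>The image is connected and contains \<open>z0\<close>; it cannot cross the
    frontier, where the distance of \<open>w ^ p\<close> to \<open>a\<close> is exactly
    \<open>\<rho>\<close>.\<close>
  have "g ` ball a \<rho> \<subseteq> \<Omega>"
  proof (rule ccontr)
    assume "\<not> ?thesis"
    then have "g ` ball a \<rho> \<inter> frontier \<Omega> \<noteq> {}"
      using rpos g_a z0
      by (intro connected_Int_frontier connected_continuous_image
            holomorphic_on_imp_continuous_on[OF g_hol])
         (auto simp: disjoint_iff intro!: bexI[of _ a])
    then obtain z where "z \<in> ball a \<rho>" "g z \<in> frontier \<Omega>" by auto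
    with fr[of "g z"] g_pow[of z] show False
      by (auto simp: dist_norm a_def norm_minus_commute)
  qed
  moreover have "\<Omega> \<subseteq> g ` ball a \<rho>"
  proof
    fix z assume z: "z \<in> \<Omega>"
    have in_ball: "x ^ p \<in> ball a \<rho>" if "x \<in> \<Omega>" for x using img that by blast
    have gnz: "g (x ^ p) \<noteq> 0" for x using z0nz by (simp add: g_def)
    \<comment> \<open>This continuous quotient takes values in the finite set of \<open>p\<close>-th
      roots of unity, hence is constant; its value at \<open>z0\<close> is 1.\<close>
    have "(\<lambda>x. x / g (x ^ p)) constant_on \<Omega>"
    proof (rule continuous_finite_range_constant[OF con])
      have "continuous_on \<Omega> (g \<circ> (\<lambda>x. x ^ p))"
        using img by (intro continuous_on_compose continuous_intros)
           (auto intro!: holomorphic_on_imp_continuous_on[OF g_hol])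
      then show "continuous_on \<Omega> (\<lambda>x. x / g (x ^ p))"
        using gnz by (intro continuous_intros) (auto simp: o_def)
      have "(\<lambda>x. x / g (x ^ p)) ` \<Omega> \<subseteq> {u. u ^ p = 1}"
        using g_pow[OF in_ball] nz closure_subset[of \<Omega>] by (auto simp: power_divide)
      moreover have "finite {u :: complex. u ^ p = 1}"
        using p by (intro finite_roots_unity) auto
      ultimately show "finite ((\<lambda>x. x / g (x ^ p)) ` \<Omega>)" using finite_subset by blast
    qed
    then have "z / g (z ^ p) = z0 / g (z0 ^ p)"
      using z z0 by (auto simp: constant_on_def)
    then have "z = g (z ^ p)" using gnz[of z] g_a z0nz by (simp add: a_def divide_simps)
    then show "z \<in> g ` ball a \<rho>" using in_ball[OF z] by blast
  qed
  ultimately show ?thesis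
    unfolding is_pth_root_of_disc_def using rpos \<open>\<rho> < norm a\<close> g_hol g_pow by blast
qed

text \<open>The functions \<open>exp (\<i> * F)\<close> and \<open>exp (- \<i> * F)\<close> have
  modulus 1 on the frontier. The maximum principle bounds \<open>Im F\<close> from both sides by 0,
  and a nonconstant \<open>F\<close> would have an open image inside the real line.\<close>

lemma holomorphic_constant_if_real_on_frontier:
  fixes F :: "complex \<Rightarrow> complex"
  assumes op: "open \<Omega>" and con: "connected \<Omega>" and bdd: "bounded \<Omega>"
    and hol: "F holomorphic_on \<Omega>" and cont: "continuous_on (closure \<Omega>) F"
    and re: "\<And>w. w \<in> frontier \<Omega> \<Longrightarrow> Im (F w) = 0"
  shows "\<exists>c. \<forall>z\<in>closure \<Omega>. F z = c"
proof -
  have "Im (F z) = 0" if z: "z \<in> \<Omega>" for z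
  proof -
    have "norm (exp (s * F z)) \<le> 1" if "s = \<i> \<or> s = -\<i>" for s
    proof (rule maximum_modulus_frontier[of "\<lambda>z. exp (s * F z)" \<Omega>])
      show "(\<lambda>z. exp (s * F z)) holomorphic_on interior \<Omega>"
        using hol op by (intro holomorphic_intros) (simp add: interior_open)
      show "continuous_on (closure \<Omega>) (\<lambda>z. exp (s * F z))"
        by (intro continuous_intros cont)
    qed (use that bdd re z in auto)
    from this[of \<i>] this[of "-\<i>"] show ?thesis by auto
  qed
  then have "F ` \<Omega> \<subseteq> {z. Im z = 0}" by auto
  have "F constant_on \<Omega>"
  proof (rule ccontr)
    assume nc: "\<not> ?thesis"
    then have ne: "\<Omega> \<noteq> {}" by (auto simp: constant_on_def)
    have "open (F ` \<Omega>)" by (rule open_mapping_thm[OF hol op con op _ nc]) auto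
    then have "F ` \<Omega> \<subseteq> interior {z. Im z = 0}"
      using \<open>F ` \<Omega> \<subseteq> _\<close> by (simp add: interior_maximal)
    also have "interior {z. Im z = 0} = {}"
      using interior_hyperplane[of \<i> 0] by (simp add: inner_complex_def)
    finally show False using ne by auto
  qed
  then obtain c where "\<And>z. z \<in> \<Omega> \<Longrightarrow> F z = c" by (auto simp: constant_on_def)
  then have "F z = c" if "z \<in> closure \<Omega>" for z
    using continuous_constant_on_closure[OF cont _ that] by auto
  then show ?thesis by blast
qed

text \<open>The factor \<open>w\<^sup>p - z0\<^sup>p\<close> cancels the pole at \<open>z0\<close>, so \<open>|w\<^sup>p - z0\<^sup>p|\<^sup>2\<close> is
  the boundary value of a holomorphic function.\<close>

lemma pth_root_of_disc_if_cnj_power_boundary_value: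
  fixes p :: nat and \<Omega> :: "complex set"
  assumes p: "p \<ge> 1" and op: "open \<Omega>" and con: "connected \<Omega>" and bdd: "bounded \<Omega>"
    and nz: "0 \<notin> closure \<Omega>" and z0: "z0 \<in> \<Omega>"
    and hol: "H holomorphic_on \<Omega>" and cont: "continuous_on (closure \<Omega>) H"
    and fr: "\<And>w. w \<in> frontier \<Omega> \<Longrightarrow> cnj w ^ p = k / (w - z0) + H w"
  shows "is_pth_root_of_disc p \<Omega>"
proof -
  \<comment> \<open>The polynomial quotient of \<open>w ^ p - z0 ^ p\<close> by
    \<open>w - z0\<close>. Thus \<open>S w * k\<close> is the product of
    \<open>w ^ p - z0 ^ p\<close> with the polar term, continued across \<open>z0\<close>.\<close>
  define S where "S = (\<lambda>w. \<Sum>i<p. z0 ^ (p - Suc i) * w ^ i)"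
  define F where "F = (\<lambda>w. S w * k + (w ^ p - z0 ^ p) * (H w - cnj (z0 ^ p)))"
  have bv: "F w = of_real ((norm (w ^ p - z0 ^ p))\<^sup>2)" if w: "w \<in> frontier \<Omega>" for w
  proof -
    have "w \<noteq> z0" using w z0 op by (auto simp: frontier_def interior_open)
    moreover have "w ^ p - z0 ^ p = (w - z0) * S w"
      unfolding S_def by (rule power_diff_sumr2)
    ultimately have "S w * k = (w ^ p - z0 ^ p) * (k / (w - z0))" by simp
    then have "F w = (w ^ p - z0 ^ p) * (k / (w - z0) + H w - cnj (z0 ^ p))"
      by (simp add: F_def ring_distribs)
    also have "\<dots> = (w ^ p - z0 ^ p) * cnj (w ^ p - z0 ^ p)" using fr[OF w] by simp
    finally show ?thesis by (simp only: complex_norm_square)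
  qed
  have "\<exists>c. \<forall>z\<in>closure \<Omega>. F z = c"
  proof (rule holomorphic_constant_if_real_on_frontier[OF op con bdd])
    show "F holomorphic_on \<Omega>"
      unfolding F_def S_def by (intro holomorphic_intros hol)
    show "continuous_on (closure \<Omega>) F"
      unfolding F_def S_def by (intro continuous_intros cont)
    show "Im (F w) = 0" if "w \<in> frontier \<Omega>" for w using bv[OF that] by simp
  qed
  then obtain c where c: "\<And>z. z \<in> closure \<Omega> \<Longrightarrow> F z = c" by blast
  show ?thesis
  proof (rule pth_root_of_disc_if_frontier_lemniscate[OF p op con bdd nz z0])
    fix w assume w: "w \<in> frontier \<Omega>"
    then have "of_real ((norm (w ^ p - z0 ^ p))\<^sup>2) = c"
      using bv[OF w] c[of w] by (auto simp: frontier_def)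
    then have "(norm (w ^ p - z0 ^ p))\<^sup>2 = Re c" by (metis Re_complex_of_real)
    then show "norm (w ^ p - z0 ^ p) = sqrt (Re c)"
      by (metis norm_ge_zero real_sqrt_unique)
  qed
qed

text \<open>From \<open>q\<close> one moves in a direction in which the defining function increases.
  The points reached have positive value, and the set of such points in \<open>U\<close> is open and
  disjoint from \<open>\<Omega>\<close>. This excludes slits, across which exterior information
  would not reach the boundary.\<close>

lemma frontier_point_in_closure_of_exterior:
  assumes "open \<Omega>" "smooth_boundary \<Omega>" "q \<in> frontier \<Omega>"
  shows "q \<in> closure (- closure \<Omega>)"
proof -
  obtain U \<rho> where U: "open U" "q \<in> U" "Cinf_on \<rho> U"
      and crit: "frechet_derivative \<rho> (at q) \<noteq> (\<lambda>v. 0)"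
      and eq: "\<Omega> \<inter> U = {z \<in> U. (\<rho> :: complex \<Rightarrow> real) z < 0}"
    using assms(2,3) unfolding smooth_boundary_def by metis
  have "Ck_on 1 \<rho> U" using U by (simp add: Cinf_on_def)
  then have diff: "\<rho> differentiable_on U" by simp
  have ct: "continuous_on U \<rho>" using diff by (rule differentiable_imp_continuous_on)
  have "\<rho> differentiable (at q)" using diff U by (simp add: differentiable_on_eq_differentiable_at)
  then have D: "(\<rho> has_derivative frechet_derivative \<rho> (at q)) (at q)"
    using frechet_derivative_works by blast
  have qn: "q \<notin> \<Omega>" "q \<in> closure \<Omega>"
    using assms by (auto simp: frontier_def interior_open)
  have pos: "z \<in> - closure \<Omega>" if "z \<in> U" "\<rho> z > 0" for z
  proof -
    have "open {z \<in> U. \<rho> z > 0}"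
      using continuous_open_preimage[OF ct U(1), of "{0<..}"]
      by (simp add: vimage_def Int_def)
    moreover have "{z \<in> U. \<rho> z > 0} \<inter> \<Omega> = {}" using eq by force
    ultimately show ?thesis using that open_Int_closure_eq_empty by blast
  qed
  have "linear (frechet_derivative \<rho> (at q))" using D has_derivative_linear by blast
  obtain u where u: "frechet_derivative \<rho> (at q) u \<noteq> 0" using crit by auto
  define v where "v = (if frechet_derivative \<rho> (at q) u > 0 then u else - u)"
  have v: "frechet_derivative \<rho> (at q) v > 0"
    using u linear_neg[OF \<open>linear _\<close>, of u] by (auto simp: v_def)
  have "((\<lambda>t. q + t *\<^sub>R v) has_derivative (\<lambda>t. t *\<^sub>R v)) (at (0::real))"
    by (auto intro!: derivative_eq_intros)
  then have "((\<lambda>t. \<rho> (q + t *\<^sub>R v)) has_derivative (\<lambda>t. frechet_derivative \<rho> (at q) (t *\<^sub>R v))) (at (0::real))"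
    using has_derivative_compose[of "\<lambda>t. q + t *\<^sub>R v" _ "0::real" UNIV \<rho>] D by simp
  then have "((\<lambda>t. \<rho> (q + t *\<^sub>R v)) has_real_derivative (frechet_derivative \<rho> (at q) v)) (at 0)"
    using \<open>linear _\<close> by (simp add: has_field_derivative_def linear_cmul mult.commute[of _ "frechet_derivative \<rho> (at q) v"] fun_eq_iff)
  from DERIV_pos_inc_right[OF this v] obtain d where d: "d > 0"
    and inc: "\<And>h. h > 0 \<Longrightarrow> h < d \<Longrightarrow> \<rho> q < \<rho> (q + h *\<^sub>R v)" by auto
  \<comment> \<open>Because \<open>q\<close> lies in \<open>U\<close> but not in the open set
    \<open>\<Omega>\<close>; with \<open>inc\<close> the values on the short ray are
    positive.\<close>
  have "\<rho> q \<ge> 0" using qn eq U by force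
  have lim: "((\<lambda>t. q + t *\<^sub>R v) \<longlongrightarrow> q + 0 *\<^sub>R v) (at_right 0)"
    by (intro tendsto_intros)
  then have "eventually (\<lambda>t. q + t *\<^sub>R v \<in> U) (at_right 0)"
    using U topological_tendstoD by fastforce
  moreover have "eventually (\<lambda>t. t \<in> {0<..<d}) (at_right 0)"
    using d eventually_at_right_real by blast
  ultimately have "eventually (\<lambda>t. q + t *\<^sub>R v \<in> - closure \<Omega>) (at_right 0)"
  proof eventually_elim
    case (elim t)
    then show ?case using inc[of t] \<open>\<rho> q \<ge> 0\<close> by (intro pos) auto
  qed
  then have "eventually (\<lambda>t. q + t *\<^sub>R v \<in> closure (- closure \<Omega>)) (at_right 0)"
    by (rule eventually_mono) (use closure_subset in blast)
  from Lim_in_closed_set[OF closed_closure this _ lim] show ?thesis by simp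
qed

theorem theorem3:
  fixes p :: nat and \<Omega> :: "complex set"
  assumes "p \<ge> 1"
    and "smooth_bounded_domain \<Omega>"
    and "0 \<notin> closure \<Omega>"
    and "one_point_quadrature_domain p \<Omega>"
  shows "is_pth_root_of_disc p \<Omega>"
proof -
  have dom: "open \<Omega>" "connected \<Omega>" "bounded \<Omega>" "smooth_boundary \<Omega>"
    using assms(2) by (auto simp: smooth_bounded_domain_def)
  obtain c z0 where z0: "z0 \<in> \<Omega>" and quad: "\<And>f. f \<in> A_infinity \<Omega> \<Longrightarrow>
      (LINT z:\<Omega>|lebesgue. f z * complex_of_real (norm z ^ (2 * p - 2))) = c * f z0"
    using assms(4) by (auto simp: one_point_quadrature_domain_def)
  define C where "C = cauchy_transform \<Omega> (\<lambda>z. cnj z ^ (p - 1))"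
  define k where "k = c / z0 ^ (p - 1)"
  define H where "H = (\<lambda>w. C w - of_real pi * cnj w ^ p / of_nat p)"
  have contC: "continuous_on X C" for X
  proof -
    obtain M where M: "\<And>z. z \<in> \<Omega> \<Longrightarrow> norm z \<le> M"
      using dom by (auto simp: bounded_iff)
    then show ?thesis unfolding C_def using dom
      by (intro continuous_on_cauchy_transform[where B = "M ^ (p - 1)"] emeasure_bounded_finite
            borel_measurable_continuous_onI continuous_intros)
         (auto simp: norm_power intro!: power_mono)
  qed
  have holH: "H holomorphic_on \<Omega>"
    unfolding H_def C_def by (rule cauchy_transform_cnj_power_holomorphic[OF dom(1,3) assms(1)])
  have contH: "continuous_on X H" for X
    unfolding H_def using assms(1) by (intro continuous_intros contC) auto
  have bdry: "C w = k / (w - z0)" if w: "w \<in> frontier \<Omega>" for w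
  proof -
    \<comment> \<open>The closure of the exterior misses \<open>z0\<close>, so
      \<open>k / (w - z0)\<close> is continuous there and the exterior identity passes to the
      boundary.\<close>
    have "closure (- closure \<Omega>) \<subseteq> - \<Omega>"
      using dom closure_subset[of \<Omega>] by (intro closure_minimal) auto
    then have "continuous_on (closure (- closure \<Omega>)) (\<lambda>w. C w - k / (w - z0))"
      using z0 by (intro continuous_intros contC) auto
    moreover have "C w - k / (w - z0) = 0" if "w \<in> - closure \<Omega>" for w
      using cauchy_transform_exterior[OF dom(1) assms(3) quad] that by (simp add: C_def k_def)
    ultimately have "C w - k / (w - z0) = 0"
      using frontier_point_in_closure_of_exterior[OF dom(1,4) w]
      by (rule continuous_constant_on_closure)
    then show ?thesis by simp
  qed
  show ?thesis
  \<comment> \<open>Solving \<open>k / (w - z0) = H w + pi * cnj w ^ p / p\<close> for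
    \<open>cnj w ^ p\<close> gives the polar coefficient \<open>p * k / pi\<close> and the
    holomorphic part \<open>- (p / pi) * H w\<close>.\<close>
  proof (rule pth_root_of_disc_if_cnj_power_boundary_value[OF assms(1) dom(1-3) assms(3) z0])
    show "(\<lambda>w. - (of_nat p / of_real pi) * H w) holomorphic_on \<Omega>"
      by (intro holomorphic_intros holH)
    show "continuous_on (closure \<Omega>) (\<lambda>w. - (of_nat p / of_real pi) * H w)"
      by (intro continuous_intros contH) auto
    fix w assume "w \<in> frontier \<Omega>"
    from bdry[OF this] have "H w = k / (w - z0) - of_real pi * cnj w ^ p / of_nat p"
      by (simp add: H_def)
    then have "- (of_nat p / of_real pi) * H w = cnj w ^ p - of_nat p * k / of_real pi / (w - z0)"
      using assms(1) by (simp add: right_diff_distrib)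
    then show "cnj w ^ p = of_nat p * k / of_real pi / (w - z0) + - (of_nat p / of_real pi) * H w"
      by simp
  qed
qed

end
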